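(* Let $m\ge 3$ and let $C_1,\ldots,C_m$ be $n\times n$ real symmetric matrices, each of which is nonzero and singular. Suppose that $C_1,\ldots,C_{m-1}$ are SDC. Then there exist an integer $p<n$, a nonsingular real $n\times n$ matrix $Q$ and a vector $\mu=(\mu_1,\ldots,\mu_{m-2},1)\in\mathbb{R}^{m-1}$ with positive entries such that, defining $S_1=C_1$ and $S_{i}=\mu_{i-1}S_{i-1}+C_{i}$ for $i=2,\ldots,m-1$ (so $S_2=\mu_1C_1+C_2$, $S_3=\mu_2(\mu_1C_1+C_2)+C_3$, etc.), $$\bar C_i=Q^TS_iQ=\mathrm{diag}\big((C_{i1})_p,0_{n-p}\big),\qquad i=1,\ldots,m-1,$$ where the $p\times p$ matrices $C_{i1}$, $i=1,\ldots,m-1$, are all diagonal and, in particular, $C_{(m-1)1}$ is nonsingular, and such that $\bar C_m=Q^TC_mQ$ has one of the following two forms: either (a) $\bar C_m=\begin{pmatrix}(C_{m1})_p& C_{m2}\\ C_{m2}^T&0_{n-p}\end{pmatrix}$ with $C_{m1}$ symmetric; or (b) $\bar C_m=\begin{pmatrix}(C_{m1})_p&0&C_{m5}\\0&(C_{m6})_s&0\\ C_{m5}^T&0&0_{n-p-s}\end{pmatrix}$ with $s\le n-p$, $C_{m1}$ symmetric, $C_{m6}$ nonsingular diagonal, and $C_{m5}$ a $p\times(n-p-s)$ matrix if $s<n-p$, while $C_{m5}$ does not exist if $s=n-p$. Moreover, the following three statements are equivalent: (i) $C_1,\ldots,C_m$ are SDC; (ii) $\bar C_1,\ldots,\bar C_m$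 are SDC; (iii) either (in form (a)) $C_{11},C_{21},\ldots,C_{m1}$ are SDC and $C_{m2}=0$; or (in form (b)) $C_{11},C_{21},\ldots,C_{m1}$ are SDC and either $C_{m5}=0$ or $C_{m5}$ does not exist.
   Context: A collection of real symmetric matrices of the same size is SDC (simultaneously diagonalizable via congruence) if there is a nonsingular real matrix $P$ such that $P^TMP$ is (real) diagonal for every matrix $M$ in the collection. The notation $(M)_k$ means that the block $M$ is of size $k\times k$; $0_k$ is the $k\times k$ zero matrix; $\mathrm{diag}(\cdot)$ denotes a block diagonal matrix.
   Formalization: The bound p<n fails in general (n=2, m=3, C_1=C_3=diag(1,0), C_2=diag(0,1) force p=2), so p≤n is stated instead, together with: p<n exactly when C_1,…,C_{m-1} have a common nonzero kernel vector. *)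

theory Defs
  imports "Jordan_Normal_Form.Matrix"
begin

definition SDC :: "nat \<Rightarrow> real mat set \<Rightarrow> bool" where
  "SDC n \<M> \<longleftrightarrow>
     (\<exists>P \<in> carrier_mat n n. invertible_mat P \<and>
        (\<forall>M \<in> \<M>. diagonal_mat (transpose_mat P * M * P)))"

(* Families C, S and Cbar are indexed from 1 (the value at 0 is irrelevant), whereas vector
   entries are indexed from 0: mu_i is \<mu> $ (i - 1).  Thus S_1 = C_1 and S_(i+1) = mu_i S_i + C_(i+1). *)
fun S_seq :: "(nat \<Rightarrow> real mat) \<Rightarrow> real vec \<Rightarrow> nat \<Rightarrow> real mat" where
  "S_seq C \<mu> 0 = C 0"
| "S_seq C \<mu> (Suc 0) = C 1"
| "S_seq C \<mu> (Suc (Suc k)) = \<mu> $ k \<cdot>\<^sub>m S_seq C \<mu> (Suc k) + C (Suc (Suc k))"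

definition Cbar ::
  "nat \<Rightarrow> (nat \<Rightarrow> real mat) \<Rightarrow> real mat \<Rightarrow> real vec \<Rightarrow> nat \<Rightarrow> real mat" where
  "Cbar m C Q \<mu> i =
     (if i < m then transpose_mat Q * S_seq C \<mu> i * Q else transpose_mat Q * C m * Q)"

(* D i is the upper left p x p block C_(i1) for i = 1, ..., m; the block D m is only
   constrained by form_a and form_b below. *)
definition reduction ::
  "nat \<Rightarrow> nat \<Rightarrow> (nat \<Rightarrow> real mat) \<Rightarrow> nat \<Rightarrow> real mat \<Rightarrow> real vec \<Rightarrow> (nat \<Rightarrow> real mat) \<Rightarrow> bool" where
  "reduction n m C p Q \<mu> D \<longleftrightarrow>
     p \<le> n \<and>
     Q \<in> carrier_mat n n \<and> invertible_mat Q \<and>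
     \<mu> \<in> carrier_vec (m - 1) \<and> (\<forall>i < m - 1. \<mu> $ i > 0) \<and> \<mu> $ (m - 2) = 1 \<and>
     (\<forall>i \<in> {1..m - 1}. D i \<in> carrier_mat p p \<and> diagonal_mat (D i) \<and>
        Cbar m C Q \<mu> i = diag_block_mat [D i, 0\<^sub>m (n - p) (n - p)]) \<and>
     invertible_mat (D (m - 1))"

definition form_a :: "nat \<Rightarrow> nat \<Rightarrow> real mat \<Rightarrow> real mat \<Rightarrow> real mat \<Rightarrow> bool" where
  "form_a n p M Cm1 Cm2 \<longleftrightarrow>
     Cm1 \<in> carrier_mat p p \<and> transpose_mat Cm1 = Cm1 \<and>
     Cm2 \<in> carrier_mat p (n - p) \<and>
     M = four_block_mat Cm1 Cm2 (transpose_mat Cm2) (0\<^sub>m (n - p) (n - p))"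

(* The 3 x 3 block matrix is written with the first two block rows (and columns) grouped.
   For s = n - p the block Cm5 is p x 0, i.e. absent. *)
definition form_b ::
  "nat \<Rightarrow> nat \<Rightarrow> nat \<Rightarrow> real mat \<Rightarrow> real mat \<Rightarrow> real mat \<Rightarrow> real mat \<Rightarrow> bool" where
  "form_b n p s M Cm1 Cm5 Cm6 \<longleftrightarrow>
     s \<le> n - p \<and>
     Cm1 \<in> carrier_mat p p \<and> transpose_mat Cm1 = Cm1 \<and>
     Cm5 \<in> carrier_mat p (n - p - s) \<and>
     Cm6 \<in> carrier_mat s s \<and> diagonal_mat Cm6 \<and> invertible_mat Cm6 \<and>
     M = four_block_mat
           (diag_block_mat [Cm1, Cm6])
           (Cm5 @\<^sub>r 0\<^sub>m s (n - p - s))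
           (transpose_mat (Cm5 @\<^sub>r 0\<^sub>m s (n - p - s)))
           (0\<^sub>m (n - p - s) (n - p - s))"

end

theory Submission
  imports Defs "Jordan_Normal_Form.Determinant"
begin

text \<open>
Write \<open>congr P M\<close> for \<open>P\<^sup>T * M * P\<close> and \<open>pad p q X\<close> for
the block diagonal matrix with blocks \<open>X\<close> and zero.

\<^bold>\<open>Existence.\<close> In a basis that diagonalizes \<open>C\<^sub>1, \<dots>,
C\<^sub>m\<^sub>-\<^sub>1\<close>, ordered so that the coordinates on which some
\<open>C\<^sub>i\<close> is nonzero come first, each \<open>S\<^sub>i\<close> is diagonal and
vanishes outside the first \<open>p\<close> coordinates. If all the weights other than the last are
equal to one number \<open>t\<close>, every diagonal entry of
\<open>S\<^sub>m\<^sub>-\<^sub>1\<close> is a polynomial in \<open>t\<close> whose coefficients are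
the corresponding entries of the \<open>C\<^sub>i\<close>; a positive \<open>t\<close> that avoids
the finitely many roots of the nonzero ones makes the first \<open>p\<close> entries of
\<open>S\<^sub>m\<^sub>-\<^sub>1\<close> nonzero (\<open>S_seq_diagonal_entry_poly\<close>,
\<open>exists_positive_nonroot\<close>). What remains free is to change the last \<open>q = n -
p\<close> basis vectors and to add combinations of them to the others; this fixes every \<open>pad p
q X\<close>. It suffices to diagonalize the lower right block of \<open>C\<^sub>m\<close>, putting
its nonzero entries first, and to use them as pivots to clear the columns of the upper right block
above them. What is left is form (b), with \<open>s = 0\<close> when that lower right block is zero
(\<open>congr_to_form_b\<close>).

\<^bold>\<open>Equivalence.\<close> Forms (a) and (b) are both instances of one block matrix with
the blocks \<open>A\<close>, \<open>B\<close>, \<open>B\<^sup>T\<close> and a diagonal lower right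
block \<open>E\<close>, in which no column index carries a nonzero column of both \<open>B\<close>
and \<open>E\<close>. Suppose that \<open>P\<close> diagonalizes this matrix and all the \<open>pad
p q X\<close>, one of them with \<open>X\<close> nonsingular. Comparing \<open>pad p q X\<close>
with its diagonalization, which has the same number of nonzero columns, forces \<open>P\<close> to
be block lower triangular, up to the order of its columns (\<open>congr_pad_pad\<close>). With the
diagonal blocks \<open>P\<^sub>1, P\<^sub>4\<close> and the lower left block
\<open>P\<^sub>3\<close>, the upper right block of the congruent matrix is \<open>(P\<^sub>1\<^sup>T
* B + P\<^sub>3\<^sup>T * E) * P\<^sub>4\<close>, so that \<open>P\<^sub>1\<^sup>T * B = -
P\<^sub>3\<^sup>T * E\<close>. In each column one of the two sides is zero, hence both are;
therefore \<open>B = 0\<close>, and \<open>P\<^sub>1\<close> diagonalizes \<open>A\<close> and every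
\<open>X\<close> (\<open>SDC_block_iff\<close>). Passing between the \<open>C\<^sub>i\<close> and
the transformed matrices is harmless: the recursion for \<open>S\<^sub>i\<close> can be solved for
\<open>C\<^sub>i\<close>, and \<open>Q\<close> is nonsingular (\<open>SDC_Cbar_iff\<close>).
\<close>

definition congr :: "real mat \<Rightarrow> real mat \<Rightarrow> real mat" where
  "congr P M = P\<^sup>T * M * P"

abbreviation pad :: "nat \<Rightarrow> nat \<Rightarrow> real mat \<Rightarrow> real mat" where
  "pad p q X \<equiv> four_block_mat X (0\<^sub>m p q) (0\<^sub>m q p) (0\<^sub>m q q)"

section \<open>Invertible matrices and congruence\<close>

lemma invertible_mat_iff_det:
  fixes A :: "'a :: field mat"
  assumes A: "A \<in> carrier_mat n n"
  shows "invertible_mat A \<longleftrightarrow> det A \<noteq> 0"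
proof
  assume "invertible_mat A"
  then obtain B where "A * B = 1\<^sub>m n" "B * A = 1\<^sub>m (dim_row B)"
    using A unfolding invertible_mat_def inverts_mat_def by auto
  moreover from this have "B \<in> carrier_mat n n"
    using A by (metis carrier_matD carrier_matI index_mult_mat(2,3) index_one_mat(2,3))
  ultimately show "det A \<noteq> 0" using det_mult[OF A, of B] by auto
next
  assume "det A \<noteq> 0"
  from det_non_zero_imp_unit[OF A this, of "()"]
  obtain B where "A * B = 1\<^sub>m n" "B * A = 1\<^sub>m n" "B \<in> carrier_mat n n"
    unfolding Units_def ring_mat_def by auto
  then show "invertible_mat A" using A
    unfolding invertible_mat_def inverts_mat_def by auto
qed

lemma invertible_mat_inverse:
  fixes A :: "'a :: field mat"
  assumes A: "A \<in> carrier_mat n n" and inv: "invertible_mat A"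
  obtains B where "B \<in> carrier_mat n n" "A * B = 1\<^sub>m n" "B * A = 1\<^sub>m n" "invertible_mat B"
proof -
  from det_non_zero_imp_unit[OF A, of "()"] inv invertible_mat_iff_det[OF A]
  obtain B where B: "A * B = 1\<^sub>m n" "B * A = 1\<^sub>m n" "B \<in> carrier_mat n n"
    unfolding Units_def ring_mat_def by auto
  then have "invertible_mat B" using A
    unfolding invertible_mat_def inverts_mat_def by auto
  with B that show thesis by auto
qed

lemma invertible_mat_mult:
  fixes A B :: "'a :: field mat"
  assumes "A \<in> carrier_mat n n" "B \<in> carrier_mat n n" "invertible_mat A" "invertible_mat B"
  shows "invertible_mat (A * B)"
  using assms mult_carrier_mat[OF assms(1,2)] by (simp add: invertible_mat_iff_det[of _ n] det_mult)

lemma congr_carrier [simp, intro]: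
  assumes "P \<in> carrier_mat n k" "M \<in> carrier_mat n n"
  shows "congr P M \<in> carrier_mat k k"
  using assms unfolding congr_def by auto

lemma SDC_iff_congr:
  "SDC n \<M> \<longleftrightarrow> (\<exists>P \<in> carrier_mat n n. invertible_mat P \<and> (\<forall>M \<in> \<M>. diagonal_mat (congr P M)))"
  unfolding SDC_def congr_def ..

lemma congr_mult:
  assumes P: "P \<in> carrier_mat n k" and Q: "Q \<in> carrier_mat k l" and M: "M \<in> carrier_mat n n"
  shows "congr (P * Q) M = congr Q (congr P M)"
  using assms unfolding congr_def
  by (simp add: transpose_mult assoc_mult_mat[of _ l k _ n _ l] assoc_mult_mat[of _ l k _ n _ n]
      assoc_mult_mat[of _ k n _ n _ k] assoc_mult_mat[of _ k n _ k _ l] assoc_mult_mat[of _ n n _ k _ l]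
      assoc_mult_mat[of _ l k _ k _ l] assoc_mult_mat[of _ k n _ n _ l])

lemma congr_one: "M \<in> carrier_mat n n \<Longrightarrow> congr (1\<^sub>m n) M = M"
  unfolding congr_def by simp

lemma congr_add:
  assumes "P \<in> carrier_mat n k" "M \<in> carrier_mat n n" "N \<in> carrier_mat n n"
  shows "congr P (M + N) = congr P M + congr P N"
  using assms unfolding congr_def
  by (simp add: mult_add_distrib_mat[of _ k n _ n] add_mult_distrib_mat[of _ k n] del: assoc_mult_mat)

lemma congr_smult:
  assumes "P \<in> carrier_mat n k" "M \<in> carrier_mat n n"
  shows "congr P (a \<cdot>\<^sub>m M) = a \<cdot>\<^sub>m congr P M"
  using assms unfolding congr_def
  by (simp add: mult_smult_distrib[of _ k n _ n] mult_smult_assoc_mat[of _ k n] del: assoc_mult_mat)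

lemma transpose_congr:
  assumes P: "P \<in> carrier_mat n k" and M: "M \<in> carrier_mat n n"
  shows "(congr P M)\<^sup>T = congr P (M\<^sup>T)"
  using assms unfolding congr_def
  by (simp add: transpose_mult[of _ k n _ k] transpose_mult[of _ n n])

lemma congr_index:
  assumes "P \<in> carrier_mat n k" "M \<in> carrier_mat n n" "i < k" "j < k"
  shows "congr P M $$ (i, j) = col P i \<bullet> (M *\<^sub>v col P j)"
proof -
  have "congr P M = P\<^sup>T * (M * P)" using assms unfolding congr_def by simp
  moreover have "col (M * P) j = M *\<^sub>v col P j" using assms by (intro eq_vecI) auto
  ultimately show ?thesis using assms by simp
qed

section \<open>Ordering the diagonal entries\<close>

lemma congr_permute_cols:
  assumes P: "P \<in> carrier_mat n n" and inv: "invertible_mat P" and f: "f permutes {0..<n}"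
  defines "P' \<equiv> mat n n (\<lambda>(i, j). P $$ (i, f j))"
  shows "P' \<in> carrier_mat n n" "invertible_mat P'"
    "\<And>(M :: real mat) i j. M \<in> carrier_mat n n \<Longrightarrow> i < n \<Longrightarrow> j < n \<Longrightarrow>
      congr P' M $$ (i, j) = congr P M $$ (f i, f j)"
proof -
  show P': "P' \<in> carrier_mat n n" unfolding P'_def by simp
  have fn: "f j < n" if "j < n" for j using permutes_in_image[OF f, of j] that by auto
  have "det (P'\<^sup>T) = det (mat n n (\<lambda>(i, j). P\<^sup>T $$ (f i, j)))"
    unfolding P'_def by (rule arg_cong[of _ _ det], rule eq_matI) (use P fn in auto)
  also have "\<dots> = signof f * det P"
    using det_permute_rows[of "P\<^sup>T" n f] det_transpose[OF P] P f by simp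
  finally have "det P' = signof f * det P" using det_transpose[OF P'] by simp
  moreover have "(signof f :: real) \<noteq> 0" by (simp add: sign_def)
  ultimately show "invertible_mat P'" using inv P P' by (simp add: invertible_mat_iff_det)
  fix M :: "real mat" and i j assume "M \<in> carrier_mat n n" "i < n" "j < n"
  moreover have "col P' j = col P (f j)" if "j < n" for j
    using that fn[OF that] P unfolding P'_def by (intro eq_vecI) auto
  ultimately show "congr P' M $$ (i, j) = congr P M $$ (f i, f j)"
    using P P' fn by (simp add: congr_index del: index_mult_mat)
qed

lemma permutation_sorting:
  fixes n :: nat
  obtains f k where "f permutes {0..<n}" "k \<le> n" "\<And>j. j < n \<Longrightarrow> R (f j) \<longleftrightarrow> j < k"
proof -
  define T where "T = {j. j < n \<and> R j}"
  define k where "k = card T"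
  have T: "finite T" "T \<subseteq> {0..<n}" unfolding T_def by auto
  have k: "k \<le> n" unfolding k_def using card_mono[OF _ T(2)] by simp
  have "card ({0..<n} - T) = n - k" unfolding k_def using T by (simp add: card_Diff_subset)
  then obtain g h where g: "bij_betw g {0..<k} T" and h: "bij_betw h {k..<n} ({0..<n} - T)"
    using finite_same_card_bij[of "{0..<k}" T] finite_same_card_bij[of "{k..<n}" "{0..<n} - T"] T k
    by (auto simp: k_def)
  define f where "f j = (if j < k then g j else if j < n then h j else j)" for j
  have "bij_betw f {0..<k} T"
    by (rule bij_betw_cong[THEN iffD1, OF _ g]) (auto simp: f_def)
  moreover have "bij_betw f {k..<n} ({0..<n} - T)"
    by (rule bij_betw_cong[THEN iffD1, OF _ h]) (auto simp: f_def)
  ultimately have "bij_betw f ({0..<k} \<union> {k..<n}) (T \<union> ({0..<n} - T))"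
    by (rule bij_betw_combine) auto
  then have "bij_betw f {0..<n} {0..<n}"
    using T k by (simp add: ivl_disj_un Un_absorb1)
  then have "f permutes {0..<n}"
    by (rule bij_imp_permutes) (use k in \<open>auto simp: f_def\<close>)
  moreover have "R (f j) \<longleftrightarrow> j < k" if "j < n" for j
    using bij_betwE[OF g] bij_betwE[OF h] that by (auto simp: f_def T_def)
  ultimately show thesis using that k by blast
qed

lemma diagonal_mat_iff:
  "M \<in> carrier_mat n n \<Longrightarrow> diagonal_mat M \<longleftrightarrow> (\<forall>i<n. \<forall>j<n. i \<noteq> j \<longrightarrow> M $$ (i, j) = 0)"
  unfolding diagonal_mat_def by auto

text \<open>
Permuting the columns of a diagonalizing matrix permutes the diagonal entries of all the
transformed matrices alike, so it can bring the joint support of any subfamily to the front.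
The subfamily is a single matrix when its rank is to be read off, and the
whole family when the common kernel is to be split off.
\<close>
lemma simultaneous_diagonalization_sorted:
  assumes M: "\<And>M. M \<in> \<M> \<Longrightarrow> M \<in> carrier_mat n n" and N: "\<N> \<subseteq> \<M>"
    and SDC: "SDC n \<M>"
  obtains P k where "P \<in> carrier_mat n n" "invertible_mat P"
    "\<And>M. M \<in> \<M> \<Longrightarrow> diagonal_mat (congr P M)"
    "k \<le> n" "\<And>j. j < n \<Longrightarrow> (\<exists>N\<in>\<N>. congr P N $$ (j, j) \<noteq> 0) \<longleftrightarrow> j < k"
proof -
  from SDC obtain P where P: "P \<in> carrier_mat n n" "invertible_mat P"
    and diag: "\<And>M. M \<in> \<M> \<Longrightarrow> diagonal_mat (congr P M)"
    unfolding SDC_iff_congr by auto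
  obtain f k where f: "f permutes {0..<n}" "k \<le> n"
    "\<And>j. j < n \<Longrightarrow> (\<exists>N\<in>\<N>. congr P N $$ (f j, f j) \<noteq> 0) \<longleftrightarrow> j < k"
    using permutation_sorting[of n "\<lambda>j. \<exists>N\<in>\<N>. congr P N $$ (j, j) \<noteq> 0"] by blast
  define P' where "P' = mat n n (\<lambda>(i, j). P $$ (i, f j))"
  note P' = congr_permute_cols[OF P f(1), folded P'_def]
  have fn: "f j < n" if "j < n" for j using permutes_in_image[OF f(1), of j] that by auto
  have inj: "f i \<noteq> f j" if "i \<noteq> j" for i j using permutes_inj[OF f(1)] that by (meson injD)
  have "diagonal_mat (congr P' M)" if "M \<in> \<M>" for M
    using diag[OF that] congr_carrier[OF P'(1) M[OF that]] congr_carrier[OF P(1) M[OF that]] M[OF that]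
    by (simp add: diagonal_mat_iff[of _ n] P'(3) fn inj)
  moreover have "(\<exists>N\<in>\<N>. congr P' N $$ (j, j) \<noteq> 0) \<longleftrightarrow> j < k" if "j < n" for j
  proof -
    have "congr P' N $$ (j, j) = congr P N $$ (f j, f j)" if "N \<in> \<N>" for N
      using P'(3)[OF M] N \<open>j < n\<close> that by blast
    then show ?thesis using f(3)[OF that] by simp
  qed
  ultimately show thesis using P'(1,2) f(2) that by blast
qed

section \<open>Block matrices\<close>

lemma diagonal_four_block_iff:
  fixes A B C E :: "real mat"
  assumes "A \<in> carrier_mat p p" "B \<in> carrier_mat p q" "C \<in> carrier_mat q p" "E \<in> carrier_mat q q"
  shows "diagonal_mat (four_block_mat A B C E) \<longleftrightarrow>
    diagonal_mat A \<and> diagonal_mat E \<and> B = 0\<^sub>m p q \<and> C = 0\<^sub>m q p"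
proof
  assume R: "diagonal_mat A \<and> diagonal_mat E \<and> B = 0\<^sub>m p q \<and> C = 0\<^sub>m q p"
  then show "diagonal_mat (four_block_mat A B C E)"
    using assms unfolding diagonal_mat_def by auto
next
  let ?M = "four_block_mat A B C E"
  assume L: "diagonal_mat ?M"
  have M: "?M $$ (i, j) = 0" if "i < p + q" "j < p + q" "i \<noteq> j" for i j
    using L that assms unfolding diagonal_mat_def by auto
  have "A $$ (i, j) = 0" if "i < p" "j < p" "i \<noteq> j" for i j
    using M[of i j] that assms by auto
  moreover have "E $$ (i, j) = 0" if "i < q" "j < q" "i \<noteq> j" for i j
    using M[of "p + i" "p + j"] that assms by auto
  moreover have "B = 0\<^sub>m p q"
  proof (rule eq_matI)
    fix i j assume "i < dim_row (0\<^sub>m p q :: real mat)" "j < dim_col (0\<^sub>m p q :: real mat)"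
    then show "B $$ (i, j) = 0\<^sub>m p q $$ (i, j)"
      using M[of i "p + j"] assms by auto
  qed (use assms in auto)
  moreover have "C = 0\<^sub>m q p"
  proof (rule eq_matI)
    fix i j assume "i < dim_row (0\<^sub>m q p :: real mat)" "j < dim_col (0\<^sub>m q p :: real mat)"
    then show "C $$ (i, j) = 0\<^sub>m q p $$ (i, j)"
      using M[of "p + i" j] assms by auto
  qed (use assms in auto)
  ultimately show "diagonal_mat A \<and> diagonal_mat E \<and> B = 0\<^sub>m p q \<and> C = 0\<^sub>m q p"
    using assms unfolding diagonal_mat_def by auto
qed

text \<open>
For block lower triangular \<open>P\<close> the off-diagonal blocks of the result have the common factor
\<open>W\<close>, in which \<open>P3\<close> adds multiples of \<open>E\<close> to \<open>B\<close>.
Elimination is the choice of a \<open>P3\<close> for which columns of \<open>W * P4\<close> vanish;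
conversely, a diagonal result forces \<open>W = 0\<close> if \<open>P4\<close> is invertible.
\<close>
lemma congr_lower_triangular:
  assumes c: "P1 \<in> carrier_mat p p" "P3 \<in> carrier_mat q p" "P4 \<in> carrier_mat q q"
    "A \<in> carrier_mat p p" "B \<in> carrier_mat p q" "E \<in> carrier_mat q q" and E: "E\<^sup>T = E"
  defines "W \<equiv> P1\<^sup>T * B + P3\<^sup>T * E"
  shows "congr (four_block_mat P1 (0\<^sub>m p q) P3 P4) (four_block_mat A B (B\<^sup>T) E) =
    four_block_mat ((P1\<^sup>T * A + P3\<^sup>T * B\<^sup>T) * P1 + W * P3) (W * P4) ((W * P4)\<^sup>T) (congr P4 E)"
proof -
  have W: "W \<in> carrier_mat p q" unfolding W_def using c by auto
  have "W\<^sup>T = B\<^sup>T * P1 + E * P3"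
    unfolding W_def using c E by (simp add: transpose_add[of _ p q] transpose_mult[of _ p p _ q] transpose_mult[of _ p q _ q])
  then have WP4: "(W * P4)\<^sup>T = P4\<^sup>T * B\<^sup>T * P1 + P4\<^sup>T * E * P3"
    using c W by (simp add: transpose_mult[of _ p q _ q] mult_add_distrib_mat[of _ q q _ p])
  have "(four_block_mat P1 (0\<^sub>m p q) P3 P4)\<^sup>T = four_block_mat (P1\<^sup>T) (P3\<^sup>T) (0\<^sub>m q p) (P4\<^sup>T)"
    using c by (subst transpose_four_block_mat[of _ p p _ q _ q]) auto
  also have "\<dots> * four_block_mat A B (B\<^sup>T) E =
    four_block_mat (P1\<^sup>T * A + P3\<^sup>T * B\<^sup>T) W (P4\<^sup>T * B\<^sup>T) (P4\<^sup>T * E)"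
    unfolding W_def using c by (subst mult_four_block_mat[of _ p p _ q _ q _ _ p _ q]) auto
  also have "\<dots> * four_block_mat P1 (0\<^sub>m p q) P3 P4 =
    four_block_mat ((P1\<^sup>T * A + P3\<^sup>T * B\<^sup>T) * P1 + W * P3) (W * P4)
      (P4\<^sup>T * B\<^sup>T * P1 + P4\<^sup>T * E * P3) (P4\<^sup>T * E * P4)"
    using c W by (subst mult_four_block_mat[of _ p p _ q _ q _ _ p _ q]) auto
  finally show ?thesis unfolding congr_def WP4 .
qed

text \<open>
The freedom left after the matrices \<open>pad p q A\<close> have been brought to their final form:
with \<open>P1 = 1\<^sub>m p\<close>, changing the last \<open>q\<close> basis vectors and adding combinations
of them to the others leaves every such matrix fixed.
\<close>
lemma congr_lower_triangular_pad:
  assumes "P1 \<in> carrier_mat p p" "P3 \<in> carrier_mat q p" "P4 \<in> carrier_mat q q"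
    "A \<in> carrier_mat p p"
  shows "congr (four_block_mat P1 (0\<^sub>m p q) P3 P4) (pad p q A) = pad p q (congr P1 A)"
  using congr_lower_triangular[OF assms, of "0\<^sub>m p q" "0\<^sub>m q q"] assms by (simp add: congr_def)

lemma invertible_lower_triangular_iff:
  fixes P1 P3 P4 :: "real mat"
  assumes c: "P1 \<in> carrier_mat p p" "P3 \<in> carrier_mat q p" "P4 \<in> carrier_mat q q"
  shows "invertible_mat (four_block_mat P1 (0\<^sub>m p q) P3 P4) \<longleftrightarrow> invertible_mat P1 \<and> invertible_mat P4"
proof -
  have "four_block_mat P1 (0\<^sub>m p q) P3 P4 \<in> carrier_mat (p + q) (p + q)" using c by auto
  then show ?thesis
    using c by (simp add: invertible_mat_iff_det[of _ p] invertible_mat_iff_det[of _ q] invertible_mat_iff_det[of _ "p + q"] det_four_block_mat_upper_right_zero[of _ p _ q])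
qed

lemma lower_triangular_split:
  fixes P :: "real mat"
  assumes P: "P \<in> carrier_mat (p + q) (p + q)"
    and zero: "\<And>i j. i < p \<Longrightarrow> p \<le> j \<Longrightarrow> j < p + q \<Longrightarrow> P $$ (i, j) = 0"
  obtains P1 P3 P4 where "P1 \<in> carrier_mat p p" "P3 \<in> carrier_mat q p" "P4 \<in> carrier_mat q q"
    "P = four_block_mat P1 (0\<^sub>m p q) P3 P4" "\<And>i j. i < p \<Longrightarrow> j < p \<Longrightarrow> P1 $$ (i, j) = P $$ (i, j)"
proof
  let ?P1 = "mat p p (\<lambda>(i, j). P $$ (i, j))" and ?P3 = "mat q p (\<lambda>(i, j). P $$ (p + i, j))"
    and ?P4 = "mat q q (\<lambda>(i, j). P $$ (p + i, p + j))"
  show "P = four_block_mat ?P1 (0\<^sub>m p q) ?P3 ?P4"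
    by (rule eq_matI) (use P zero in auto)
qed auto

lemma symmetric_split:
  fixes M :: "real mat"
  assumes M: "M \<in> carrier_mat (p + q) (p + q)" and sym: "M\<^sup>T = M"
  obtains A B E where "A \<in> carrier_mat p p" "A\<^sup>T = A" "B \<in> carrier_mat p q"
    "E \<in> carrier_mat q q" "E\<^sup>T = E" "M = four_block_mat A B (B\<^sup>T) E"
    "\<And>i j. i < q \<Longrightarrow> j < q \<Longrightarrow> E $$ (i, j) = M $$ (p + i, p + j)"
proof
  have s: "M $$ (i, j) = M $$ (j, i)" if "i < p + q" "j < p + q" for i j
    using arg_cong[OF sym, of "\<lambda>M. M $$ (j, i)"] M that by auto
  let ?A = "mat p p (\<lambda>(i, j). M $$ (i, j))" and ?B = "mat p q (\<lambda>(i, j). M $$ (i, p + j))"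
    and ?E = "mat q q (\<lambda>(i, j). M $$ (p + i, p + j))"
  show "M = four_block_mat ?A ?B (?B\<^sup>T) ?E" by (rule eq_matI) (use M s in auto)
  show "?A\<^sup>T = ?A" "?E\<^sup>T = ?E" by (rule eq_matI; use s in simp)+
qed auto

text \<open>
The zero block is so wide that it reaches into the square block of the first \<open>p\<close> rows and
columns and fills column \<open>k\<close> there.
\<close>
lemma det_eq_0_if_zero_block:
  fixes P :: "real mat"
  assumes P: "P \<in> carrier_mat (p + q) (p + q)" and "k < p"
    and zero: "\<And>i j. i < p \<Longrightarrow> k \<le> j \<Longrightarrow> j < p + q \<Longrightarrow> P $$ (i, j) = 0"
  shows "det P = 0"
proof -
  obtain P1 P3 P4 where b: "P1 \<in> carrier_mat p p" "P3 \<in> carrier_mat q p" "P4 \<in> carrier_mat q q"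
    "P = four_block_mat P1 (0\<^sub>m p q) P3 P4" "\<And>i j. i < p \<Longrightarrow> j < p \<Longrightarrow> P1 $$ (i, j) = P $$ (i, j)"
    by (rule lower_triangular_split[OF P]) (use zero \<open>k < p\<close> in auto)
  have "P1 *\<^sub>v unit_vec p k = 0\<^sub>v p"
    by (rule eq_vecI) (use b(1,5) zero[of _ k] \<open>k < p\<close> in \<open>auto simp: scalar_prod_right_unit\<close>)
  then have "det P1 = 0"
    using det_0_iff_vec_prod_zero[OF b(1)] unit_vec_nonzero[OF \<open>k < p\<close>] unit_vec_carrier by metis
  then show ?thesis
    using b by (simp add: det_four_block_mat_upper_right_zero[of _ p _ q])
qed

lemma mult_zero_col:
  fixes L M :: "real mat"
  assumes "L \<in> carrier_mat n n" "M \<in> carrier_mat n n" "j < n" "i < n"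
    and "\<And>i. i < n \<Longrightarrow> M $$ (i, j) = 0"
  shows "(L * M) $$ (i, j) = 0"
proof -
  have "col M j = 0\<^sub>v n" by (rule eq_vecI) (use assms in auto)
  then show ?thesis using assms by simp
qed

section \<open>Congruences between padded matrices\<close>

text \<open>
Undoing \<open>P\<^sup>T\<close> and then \<open>X\<close> from the left in \<open>congr P (pad p q X)\<close> leaves the
first \<open>p\<close> rows of \<open>P\<close>. Operations from the left keep zero columns zero, so these
rows inherit the zero columns; an invertible \<open>P\<close> cannot have too many of them.
\<close>
lemma zero_corner_of_congr_pad:
  assumes X: "X \<in> carrier_mat p p" "invertible_mat X"
    and P: "P \<in> carrier_mat (p + q) (p + q)" "invertible_mat P"
    and zero: "\<And>i j. i < p + q \<Longrightarrow> k \<le> j \<Longrightarrow> j < p + q \<Longrightarrow> congr P (pad p q X) $$ (i, j) = 0"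
  shows "\<And>i j. i < p \<Longrightarrow> k \<le> j \<Longrightarrow> j < p + q \<Longrightarrow> P $$ (i, j) = 0" and "p \<le> k"
proof -
  let ?n = "p + q"
  obtain Y where Y: "Y \<in> carrier_mat p p" "Y * X = 1\<^sub>m p" using invertible_mat_inverse[OF X] by metis
  obtain R where R: "R \<in> carrier_mat ?n ?n" "P * R = 1\<^sub>m ?n"
    using invertible_mat_inverse[OF P] by metis
  have c: "pad p q X \<in> carrier_mat ?n ?n" "pad p q Y \<in> carrier_mat ?n ?n"
    "pad p q (1\<^sub>m p) \<in> carrier_mat ?n ?n" using X Y by auto
  have "pad p q Y * pad p q X = pad p q (1\<^sub>m p)"
    using X Y by (subst mult_four_block_mat[of _ p p _ q _ q _ _ p _ q]) auto
  moreover have "R\<^sup>T * P\<^sup>T = 1\<^sub>m ?n"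
    using R P by (metis transpose_mult transpose_one)
  then have "R\<^sup>T * congr P (pad p q X) = pad p q X * P"
    unfolding congr_def using R P(1) c left_mult_one_mat[OF mult_carrier_mat[OF c(1) P(1)]]
    by (simp add: assoc_mult_mat[of "P\<^sup>T" ?n ?n _ ?n _ ?n]
        assoc_mult_mat[of "R\<^sup>T" ?n ?n "P\<^sup>T" ?n _ ?n, symmetric] del: assoc_mult_mat)
  ultimately have eq: "pad p q (1\<^sub>m p) * P = pad p q Y * (R\<^sup>T * congr P (pad p q X))"
    using assoc_mult_mat[OF c(2,1) P(1)] by simp
  have "(pad p q (1\<^sub>m p) * P) $$ (i, j) = P $$ (i, j)" if "i < p" "j < ?n" for i j
  proof -
    have "row (pad p q (1\<^sub>m p)) i = unit_vec ?n i" using that by (intro eq_vecI) auto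
    then show ?thesis using that P by (simp add: scalar_prod_left_unit[of _ ?n])
  qed
  moreover have "(pad p q Y * (R\<^sup>T * congr P (pad p q X))) $$ (i, j) = 0"
    if "i < ?n" "k \<le> j" "j < ?n" for i j
    by (rule mult_zero_col[OF c(2) _ that(3,1)])
      (use R P c that zero in \<open>auto intro!: mult_zero_col simp del: index_mult_mat\<close>)
  ultimately show z: "P $$ (i, j) = 0" if "i < p" "k \<le> j" "j < ?n" for i j
    using that eq by (metis trans_less_add1)
  show "p \<le> k"
    using det_eq_0_if_zero_block[OF P(1) _ z, where k = k] P invertible_mat_iff_det[OF P(1)]
    by fastforce
qed

text \<open>
A form of the invariance of rank under congruence. The previous lemma, applied to
\<open>P\<close> and to its inverse, bounds \<open>p\<close> and \<open>k\<close> by each other.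
\<close>
lemma congr_pad_pad:
  assumes X: "X \<in> carrier_mat p p" "invertible_mat X" and Y: "Y \<in> carrier_mat k k" "invertible_mat Y"
    and P: "P \<in> carrier_mat (p + q) (p + q)" "invertible_mat P"
    and dim: "p + q = k + l" and eq: "congr P (pad p q X) = pad k l Y"
  shows "k = p" and "\<And>i j. i < p \<Longrightarrow> p \<le> j \<Longrightarrow> j < p + q \<Longrightarrow> P $$ (i, j) = 0"
proof -
  obtain R where R: "R \<in> carrier_mat (p + q) (p + q)" "P * R = 1\<^sub>m (p + q)" "invertible_mat R"
    using invertible_mat_inverse[OF P] by metis
  have "pad p q X \<in> carrier_mat (p + q) (p + q)" using X by auto
  from congr_mult[OF P(1) R(1) this] congr_one[OF this] R(2)
  have eq': "congr R (pad k l Y) = pad p q X" by (simp add: eq)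
  have "k \<le> p"
    by (rule zero_corner_of_congr_pad(2)[OF Y, of R l]) (use eq' R dim X in auto)
  moreover have z: "congr P (pad p q X) $$ (i, j) = 0" if "i < p + q" "k \<le> j" "j < p + q" for i j
    unfolding eq using that Y dim by auto
  note zero_corner_of_congr_pad[where k = k, OF X P z]
  ultimately show "k = p" "\<And>i j. i < p \<Longrightarrow> p \<le> j \<Longrightarrow> j < p + q \<Longrightarrow> P $$ (i, j) = 0" by auto
qed

text \<open>
Lets a diagonal matrix whose support was moved to the front enter block computations.
\<close>
lemma diagonal_eq_pad:
  assumes M: "M \<in> carrier_mat n n" "diagonal_mat M" and "k \<le> n"
    and z: "\<And>j. k \<le> j \<Longrightarrow> j < n \<Longrightarrow> M $$ (j, j) = 0"
  obtains Y where "Y \<in> carrier_mat k k" "diagonal_mat Y" "M = pad k (n - k) Y"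
    "(\<forall>j<k. M $$ (j, j) \<noteq> 0) \<longrightarrow> invertible_mat Y"
proof
  let ?Y = "mat k k (\<lambda>(i, j). M $$ (i, j))"
  show Y: "?Y \<in> carrier_mat k k" by simp
  show "diagonal_mat ?Y" using M \<open>k \<le> n\<close> unfolding diagonal_mat_def by auto
  then have "upper_triangular ?Y" unfolding diagonal_mat_def by (auto intro!: upper_triangularI)
  then have "det ?Y = prod_list (diag_mat ?Y)" by (rule det_upper_triangular[OF _ Y])
  then show "(\<forall>j<k. M $$ (j, j) \<noteq> 0) \<longrightarrow> invertible_mat ?Y"
    using invertible_mat_iff_det[OF Y] by (auto simp: diag_mat_def prod_list_zero_iff)
  show "M = pad k (n - k) ?Y"
  proof (rule eq_matI)
    fix i j assume "i < dim_row (pad k (n - k) ?Y)" "j < dim_col (pad k (n - k) ?Y)"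
    then show "M $$ (i, j) = pad k (n - k) ?Y $$ (i, j)"
      using M \<open>k \<le> n\<close> z[of i] by (cases "i = j") (auto simp: diagonal_mat_def)
  qed (use M \<open>k \<le> n\<close> in auto)
qed

section \<open>Diagonalizing one symmetric matrix by congruence\<close>

text \<open>
A nonzero diagonal entry can be permuted into the corner. If the diagonal vanishes, polarization
produces one: for \<open>E $$ (i, j) \<noteq> 0\<close> the vector \<open>e\<^sub>i + e\<^sub>j\<close> has the value
\<open>2 * E $$ (i, j)\<close> under the quadratic form of \<open>E\<close>. The corner is the last one
because block lower triangular congruences eliminate from the bottom up.
\<close>
lemma symmetric_nonzero_corner:
  fixes E :: "real mat"
  assumes E: "E \<in> carrier_mat (Suc q) (Suc q)" "E\<^sup>T = E" "E \<noteq> 0\<^sub>m (Suc q) (Suc q)"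
  obtains V where "V \<in> carrier_mat (Suc q) (Suc q)" "invertible_mat V" "congr V E $$ (q, q) \<noteq> 0"
proof -
  let ?n = "Suc q"
  have s: "E $$ (i, j) = E $$ (j, i)" if "i < ?n" "j < ?n" for i j
    using arg_cong[OF E(2), of "\<lambda>M. M $$ (j, i)"] E(1) that by auto
  have "\<exists>V i. V \<in> carrier_mat ?n ?n \<and> invertible_mat V \<and> i < ?n \<and> congr V E $$ (i, i) \<noteq> 0"
  proof (cases "\<exists>i<?n. E $$ (i, i) \<noteq> 0")
    case True
    have "congr (1\<^sub>m ?n) E = E" "invertible_mat (1\<^sub>m ?n :: real mat)"
      using congr_one[OF E(1)] invertible_mat_iff_det[of "1\<^sub>m ?n :: real mat" ?n] by auto
    with True one_carrier_mat show ?thesis by metis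
  next
    case False
    obtain i j where ij: "i < ?n" "j < ?n" "E $$ (i, j) \<noteq> 0"
      using E(1,3) by (metis carrier_matD(1,2) eq_matI index_zero_mat(1-3))
    with False have "i \<noteq> j" by auto
    \<comment> \<open>Column \<open>i\<close> of this elementary matrix is \<open>e\<^sub>i + e\<^sub>j\<close>.\<close>
    let ?V = "addrow_mat ?n 1 j i :: real mat"
    have V: "?V \<in> carrier_mat ?n ?n" by simp
    have "invertible_mat ?V"
      using invertible_mat_iff_det[OF V] \<open>i \<noteq> j\<close> by (simp add: det_addrow_mat)
    have col: "col ?V i = unit_vec ?n i + unit_vec ?n j"
      using ij \<open>i \<noteq> j\<close> by (intro eq_vecI) (auto simp: addrow_mat_def)
    have "E *\<^sub>v unit_vec ?n l = col E l" if "l < ?n" for l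
      using that E(1) by (intro eq_vecI) (auto simp: scalar_prod_right_unit[of _ ?n])
    then have "E *\<^sub>v col ?V i = col E i + col E j"
      unfolding col using E(1) ij by (simp add: mult_add_distrib_mat_vec[of _ ?n ?n])
    then have "congr ?V E $$ (i, i) = E $$ (i, i) + E $$ (i, j) + (E $$ (j, i) + E $$ (j, j))"
      using congr_index[OF V E(1) ij(1) ij(1)] E(1) ij
      by (simp add: col add_scalar_prod_distrib[of _ ?n] scalar_prod_left_unit[of _ ?n])
    also have "\<dots> = 2 * E $$ (i, j)" using False ij s[of i j] by auto
    finally show ?thesis using V \<open>invertible_mat ?V\<close> ij by (intro exI[of _ ?V] exI[of _ i]) auto
  qed
  then obtain V i where V: "V \<in> carrier_mat ?n ?n" "invertible_mat V" and i: "i < ?n" "congr V E $$ (i, i) \<noteq> 0"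
    by blast
  have "Transposition.transpose i q permutes {0..<?n}" using i by (intro permutes_swap_id) auto
  note V' = congr_permute_cols[OF V this]
  have "Transposition.transpose i q q = i" by simp
  with V'(3)[OF E(1), of q q] i have "congr (mat ?n ?n (\<lambda>(i', j). V $$ (i', Transposition.transpose i q j))) E $$ (q, q) \<noteq> 0"
    by simp
  with V'(1,2) that show thesis by blast
qed

text \<open>
Lagrange's reduction of a quadratic form: with a nonzero last diagonal entry as pivot, the
rest of its row and column is eliminated, and the remaining block has one dimension less.
\<close>
lemma symmetric_diagonalizable:
  assumes "E \<in> carrier_mat q q" "E\<^sup>T = E"
  obtains V where "V \<in> carrier_mat q q" "invertible_mat V" "diagonal_mat (congr V E)"
  using assms
proof (induction q arbitrary: E thesis)
  case 0
  have "1\<^sub>m 0 \<in> carrier_mat 0 0" "invertible_mat (1\<^sub>m 0 :: real mat)" "diagonal_mat (congr (1\<^sub>m 0) E)"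
    using invertible_mat_iff_det[of "1\<^sub>m 0 :: real mat" 0] 0 by (auto simp: diagonal_mat_def congr_def)
  then show thesis by (rule "0.prems")
next
  case (Suc q)
  note E = Suc.prems(2,3)
  show thesis
  proof (cases "E = 0\<^sub>m (Suc q) (Suc q)")
    case True
    then have "diagonal_mat (congr (1\<^sub>m (Suc q)) E)" by (auto simp: diagonal_mat_def congr_def)
    moreover have "invertible_mat (1\<^sub>m (Suc q) :: real mat)" using invertible_mat_iff_det[of "1\<^sub>m (Suc q) :: real mat" "Suc q"] by simp
    ultimately show thesis using Suc.prems(1) one_carrier_mat by blast
  next
    case False
    obtain V where V: "V \<in> carrier_mat (Suc q) (Suc q)" "invertible_mat V" and nz: "congr V E $$ (q, q) \<noteq> 0"
      using symmetric_nonzero_corner[OF E False] by blast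
    have VE: "congr V E \<in> carrier_mat (q + 1) (q + 1)" "(congr V E)\<^sup>T = congr V E"
      using congr_carrier[OF V(1) E(1)] transpose_congr[OF V(1) E(1)] E(2) by auto
    obtain A b e where b: "A \<in> carrier_mat q q" "A\<^sup>T = A" "b \<in> carrier_mat q 1"
      "e \<in> carrier_mat 1 1" "e\<^sup>T = e" "congr V E = four_block_mat A b (b\<^sup>T) e" 
      and e: "\<And>i j. i < 1 \<Longrightarrow> j < 1 \<Longrightarrow> e $$ (i, j) = congr V E $$ (q + i, q + j)"
      using symmetric_split[OF VE] by metis
    define a where "a = e $$ (0, 0)"
    have a: "a \<noteq> 0" "e = a \<cdot>\<^sub>m 1\<^sub>m 1" using e[of 0 0] nz b(4) by (auto simp: a_def intro!: eq_matI)
    \<comment> \<open>Chosen so that \<open>b + x\<^sup>T * e = 0\<close>.\<close>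
    define x where "x = (- 1 / a) \<cdot>\<^sub>m b\<^sup>T"
    have x: "x \<in> carrier_mat 1 q" using b unfolding x_def by auto
    let ?T = "four_block_mat (1\<^sub>m q) (0\<^sub>m q 1) x (1\<^sub>m 1)"
    have T: "?T \<in> carrier_mat (q + 1) (q + 1)" "invertible_mat ?T"
      using x by (auto simp: invertible_lower_triangular_iff invertible_mat_iff_det[of _ q] invertible_mat_iff_det[of _ 1])
    have elim: "b + x\<^sup>T * e = 0\<^sub>m q 1"
      using b a by (intro eq_matI) (auto simp: x_def scalar_prod_def)
    let ?A = "A + x\<^sup>T * b\<^sup>T"
    have A': "?A \<in> carrier_mat q q" using b x by auto
    have "b * x = x\<^sup>T * b\<^sup>T"
      using b unfolding x_def by (intro eq_matI) (auto simp: scalar_prod_def)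
    then have "?A\<^sup>T = ?A"
      using b x by (simp add: transpose_add[of _ q q] transpose_mult[of _ q 1 _ q])
    have cT: "congr ?T (congr V E) = four_block_mat ?A (0\<^sub>m q 1) (0\<^sub>m 1 q) e"
      unfolding b(6) using congr_lower_triangular[OF one_carrier_mat x one_carrier_mat b(1,3,4,5)] b x A'
      by (simp add: elim congr_def)
    obtain U where U: "U \<in> carrier_mat q q" "invertible_mat U" "diagonal_mat (congr U ?A)"
      using Suc.IH[OF _ A' \<open>?A\<^sup>T = ?A\<close>] by blast
    let ?U = "four_block_mat U (0\<^sub>m q 1) (0\<^sub>m 1 q) (1\<^sub>m 1)"
    have U': "?U \<in> carrier_mat (q + 1) (q + 1)" "invertible_mat ?U"
      using U by (auto simp: invertible_lower_triangular_iff invertible_mat_iff_det[of _ 1])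
    have UA: "congr U ?A \<in> carrier_mat q q" using U(1) A' by simp
    have "congr ?U (congr ?T (congr V E)) = four_block_mat (congr U ?A) (0\<^sub>m q 1) (0\<^sub>m 1 q) e"
      unfolding cT using congr_lower_triangular[OF U(1) zero_carrier_mat one_carrier_mat A' zero_carrier_mat b(4,5)] U b A'
      by (simp add: congr_def)
    moreover have "diagonal_mat \<dots>"
      using UA U(3) b(4) by (subst diagonal_four_block_iff[of _ q _ 1]) (auto simp: diagonal_mat_def)
    moreover have "congr ?U (congr ?T (congr V E)) = congr (V * (?T * ?U)) E"
      using congr_mult[of V "Suc q" "Suc q" "?T * ?U" "Suc q" E] congr_mult[of ?T "Suc q" "Suc q" ?U "Suc q" "congr V E"]
        V T U' E VE by simp
    ultimately have "diagonal_mat (congr (V * (?T * ?U)) E)" by simp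
    moreover have "V * (?T * ?U) \<in> carrier_mat (Suc q) (Suc q)" "invertible_mat (V * (?T * ?U))"
      using V T U' invertible_mat_mult[of ?T "Suc q" ?U] invertible_mat_mult[of V "Suc q" "?T * ?U"] by auto
    ultimately show thesis using Suc.prems(1) by blast
  qed
qed

section \<open>Simultaneous diagonalization of block matrices\<close>

text \<open>
The equivalence of (ii) and (iii), for forms (a) and (b) at once: in form (a) the block
\<open>E\<close> is zero, and in form (b) the first \<open>s\<close> columns of \<open>B\<close> and the
other columns of \<open>E\<close> are zero. The invertible member \<open>N\<close> of the family pins
down the shape of a diagonalizing matrix.
\<close>
lemma SDC_block_iff:
  assumes D: "\<And>X. X \<in> \<D> \<Longrightarrow> X \<in> carrier_mat p p" and N: "N \<in> \<D>" "invertible_mat N"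
    and c: "A \<in> carrier_mat p p" "B \<in> carrier_mat p q" "E \<in> carrier_mat q q"
    and E: "diagonal_mat E"
    and cols: "\<And>j. j < q \<Longrightarrow> col B j = 0\<^sub>v p \<or> col E j = 0\<^sub>v q"
  shows "SDC (p + q) (insert (four_block_mat A B (B\<^sup>T) E) (pad p q ` \<D>)) \<longleftrightarrow>
    SDC p (insert A \<D>) \<and> B = 0\<^sub>m p q"
proof
  let ?M = "four_block_mat A B (B\<^sup>T) E"
  have M: "?M \<in> carrier_mat (p + q) (p + q)" and pad: "\<And>X. X \<in> \<D> \<Longrightarrow> pad p q X \<in> carrier_mat (p + q) (p + q)"
    using c D by auto
  have ET: "E\<^sup>T = E"
  proof (rule eq_matI)
    fix i j assume "i < dim_row E" "j < dim_col E"
    then show "E\<^sup>T $$ (i, j) = E $$ (i, j)"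
      using c(3) E by (cases "i = j") (auto simp: diagonal_mat_def)
  qed (use c in auto)
  {
    assume "SDC (p + q) (insert ?M (pad p q ` \<D>))"
    note sdc = this
    have carr: "X \<in> carrier_mat (p + q) (p + q)" if "X \<in> insert ?M (pad p q ` \<D>)" for X
      using that M pad by auto
    obtain P k where P: "P \<in> carrier_mat (p + q) (p + q)" "invertible_mat P"
      and diag: "\<And>M. M \<in> insert ?M (pad p q ` \<D>) \<Longrightarrow> diagonal_mat (congr P M)"
      and k: "k \<le> p + q" "\<And>j. j < p + q \<Longrightarrow> (\<exists>M\<in>{pad p q N}. congr P M $$ (j, j) \<noteq> 0) \<longleftrightarrow> j < k"
      using simultaneous_diagonalization_sorted[OF carr _ sdc, of "{pad p q N}"] N(1) by blast
    have zero: "congr P (pad p q N) $$ (j, j) = 0" if "k \<le> j" "j < p + q" for j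
      using k(2)[of j] that by auto
    have "diagonal_mat (congr P (pad p q N))" using diag N(1) by auto
    from diagonal_eq_pad[OF congr_carrier[OF P(1) pad[OF N(1)]] this k(1) zero]
    obtain Y where Y: "Y \<in> carrier_mat k k" "diagonal_mat Y" "congr P (pad p q N) = pad k (p + q - k) Y"
      and Y_inv: "(\<forall>j<k. congr P (pad p q N) $$ (j, j) \<noteq> 0) \<longrightarrow> invertible_mat Y" by blast
    have "invertible_mat Y" using Y_inv k by simp
    \<comment> \<open>The diagonalized \<open>pad p q N\<close> has its nonzero entries in front, so \<open>P\<close> is block lower triangular.\<close>
    have "P $$ (i, j) = 0" if "i < p" "p \<le> j" "j < p + q" for i j
      using congr_pad_pad(2)[OF D[OF N(1)] N(2) Y(1) \<open>invertible_mat Y\<close> P _ Y(3)] k that by simp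
    with lower_triangular_split[OF P(1)]
    obtain P1 P3 P4 where b: "P1 \<in> carrier_mat p p" "P3 \<in> carrier_mat q p" "P4 \<in> carrier_mat q q"
      and Pb: "P = four_block_mat P1 (0\<^sub>m p q) P3 P4" by metis
    have inv: "invertible_mat P1" "invertible_mat P4"
      using P(2) invertible_lower_triangular_iff[OF b] unfolding Pb by auto
    have D1: "diagonal_mat (congr P1 X)" if "X \<in> \<D>" for X
    proof -
      have "diagonal_mat (pad p q (congr P1 X))"
        using diag[of "pad p q X"] that congr_lower_triangular_pad[OF b D[OF that]] Pb by simp
      then show ?thesis
        using diagonal_four_block_iff[OF congr_carrier[OF b(1) D[OF that]] zero_carrier_mat zero_carrier_mat zero_carrier_mat]
        by simp
    qed
    define W where "W = P1\<^sup>T * B + P3\<^sup>T * E"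
    have W: "W \<in> carrier_mat p q" unfolding W_def using b c by auto
    have "congr P ?M = four_block_mat ((P1\<^sup>T * A + P3\<^sup>T * B\<^sup>T) * P1 + W * P3) (W * P4) ((W * P4)\<^sup>T) (congr P4 E)"
      unfolding Pb W_def by (rule congr_lower_triangular[OF b c ET])
    with diag[of ?M]
    have "diagonal_mat (four_block_mat ((P1\<^sup>T * A + P3\<^sup>T * B\<^sup>T) * P1 + W * P3) (W * P4) ((W * P4)\<^sup>T) (congr P4 E))"
      by simp
    then have d: "diagonal_mat ((P1\<^sup>T * A + P3\<^sup>T * B\<^sup>T) * P1 + W * P3)" "W * P4 = 0\<^sub>m p q"
      using b c W by (subst (asm) diagonal_four_block_iff[of _ p _ q]; auto)+
    obtain R4 where R4: "R4 \<in> carrier_mat q q" "P4 * R4 = 1\<^sub>m q"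
      using invertible_mat_inverse[OF b(3) inv(2)] by metis
    \<comment> \<open>The upper right block is zero, and \<open>P4\<close> can be cancelled from it.\<close>
    have "W = (W * P4) * R4" using W b R4 by (simp add: assoc_mult_mat[of _ p q _ q _ q])
    then have W0: "W = 0\<^sub>m p q" using d(2) R4 by simp
    obtain R1 where R1: "R1 \<in> carrier_mat p p" "P1 * R1 = 1\<^sub>m p"
      using invertible_mat_inverse[OF b(1) inv(1)] by metis
    have "R1\<^sup>T * P1\<^sup>T = 1\<^sub>m p" using R1 b by (metis transpose_mult transpose_one)
    \<comment> \<open>In each column one of the two summands of \<open>W\<close> vanishes, hence both do.\<close>
    have "P1\<^sup>T * B = 0\<^sub>m p q"
    proof (rule eq_matI)
      fix i j assume "i < dim_row (0\<^sub>m p q :: real mat)" "j < dim_col (0\<^sub>m p q :: real mat)"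
      then have ij: "i < p" "j < q" by auto
      have "(P1\<^sup>T * B) $$ (i, j) + (P3\<^sup>T * E) $$ (i, j) = 0"
        using arg_cong[OF W0, of "\<lambda>W. W $$ (i, j)"] ij b c unfolding W_def by simp
      with cols[OF ij(2)] show "(P1\<^sup>T * B) $$ (i, j) = 0\<^sub>m p q $$ (i, j)"
        using ij b c by auto
    qed (use b c in auto)
    then have "R1\<^sup>T * P1\<^sup>T * B = 0\<^sub>m p q"
      using R1 b c by (simp add: assoc_mult_mat[of _ p p _ p _ q])
    then have B0: "B = 0\<^sub>m p q" using \<open>R1\<^sup>T * P1\<^sup>T = 1\<^sub>m p\<close> c by simp
    have "diagonal_mat (congr P1 A)"
      using d(1) b c unfolding B0 W0 by (simp add: congr_def)
    with D1 b(1) inv(1) B0 show "SDC p (insert A \<D>) \<and> B = 0\<^sub>m p q"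
      unfolding SDC_iff_congr by auto
  next
    assume R: "SDC p (insert A \<D>) \<and> B = 0\<^sub>m p q"
    then obtain P1 where P1: "P1 \<in> carrier_mat p p" "invertible_mat P1"
      and diag: "\<And>X. X \<in> insert A \<D> \<Longrightarrow> diagonal_mat (congr P1 X)"
      unfolding SDC_iff_congr by blast
    let ?P = "four_block_mat P1 (0\<^sub>m p q) (0\<^sub>m q p) (1\<^sub>m q)"
    note b = P1(1) zero_carrier_mat[of q p] one_carrier_mat[of q]
    have "?P \<in> carrier_mat (p + q) (p + q)" "invertible_mat ?P"
      using P1 invertible_lower_triangular_iff[OF b] invertible_mat_iff_det[of "1\<^sub>m q :: real mat" q] by auto
    moreover have "diagonal_mat (congr ?P ?M)"
    proof -
      have "congr ?P ?M = four_block_mat (congr P1 A) (0\<^sub>m p q) (0\<^sub>m q p) E"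
        using congr_lower_triangular[OF b c ET] R c P1 by (simp add: congr_def)
      then show ?thesis
        using diagonal_four_block_iff[OF congr_carrier[OF P1(1) c(1)] zero_carrier_mat zero_carrier_mat c(3)] diag E
        by simp
    qed
    moreover have "diagonal_mat (congr ?P (pad p q X))" if "X \<in> \<D>" for X
      using congr_lower_triangular_pad[OF b D[OF that]] diag[of X] that
        diagonal_four_block_iff[OF congr_carrier[OF P1(1) D[OF that]] zero_carrier_mat zero_carrier_mat zero_carrier_mat]
      by (auto simp: diagonal_mat_def)
    ultimately show "SDC (p + q) (insert ?M (pad p q ` \<D>))"
      unfolding SDC_iff_congr by blast
  }
qed

text \<open>
The upper right \<open>p \<times> q\<close> block of form (b): the \<open>s\<close> columns above the
nonsingular diagonal block vanish.
\<close>
definition prepend_zero_cols :: "nat \<Rightarrow> nat \<Rightarrow> nat \<Rightarrow> real mat \<Rightarrow> real mat" where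
  "prepend_zero_cols p q s K = four_block_mat (0\<^sub>m p s) K (0\<^sub>m 0 s) (0\<^sub>m 0 (q - s))"

text \<open>
Form (b) groups the \<open>3 \<times> 3\<close> blocks as \<open>(p + s) + (q - s)\<close>. Regrouping them as
\<open>p + q\<close> makes the form an instance of the block matrices treated above.
\<close>
lemma form_b_eq_four_block:
  fixes A K L :: "real mat"
  assumes "s \<le> q" and A: "A \<in> carrier_mat p p" and K: "K \<in> carrier_mat p (q - s)" and L: "L \<in> carrier_mat s s"
  shows "four_block_mat (diag_block_mat [A, L]) (K @\<^sub>r 0\<^sub>m s (q - s))
      ((K @\<^sub>r 0\<^sub>m s (q - s))\<^sup>T) (0\<^sub>m (q - s) (q - s)) =
    four_block_mat A (prepend_zero_cols p q s K) ((prepend_zero_cols p q s K)\<^sup>T) (pad s (q - s) L)"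
  by (rule eq_matI) (use assms in \<open>auto simp: Let_def append_rows_def prepend_zero_cols_def\<close>)

lemma prepend_zero_cols_eq_0_iff:
  assumes "s \<le> q" and K: "K \<in> carrier_mat p (q - s)"
  shows "prepend_zero_cols p q s K = 0\<^sub>m p q \<longleftrightarrow> K = 0\<^sub>m p (q - s)"
proof
  assume L: "prepend_zero_cols p q s K = 0\<^sub>m p q"
  show "K = 0\<^sub>m p (q - s)"
  proof (rule eq_matI)
    fix i j assume "i < dim_row (0\<^sub>m p (q - s) :: real mat)" "j < dim_col (0\<^sub>m p (q - s) :: real mat)"
    then show "K $$ (i, j) = 0\<^sub>m p (q - s) $$ (i, j)"
      using arg_cong[OF L, of "\<lambda>M. M $$ (i, s + j)"] assms by (auto simp: prepend_zero_cols_def)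
  qed (use K in auto)
next
  assume "K = 0\<^sub>m p (q - s)"
  then show "prepend_zero_cols p q s K = 0\<^sub>m p q" using \<open>s \<le> q\<close> by (simp add: prepend_zero_cols_def)
qed

section \<open>The accumulated matrices \<open>S\<^sub>i\<close>\<close>

lemma S_seq_Suc: "1 \<le> i \<Longrightarrow> S_seq C \<mu> (Suc i) = \<mu> $ (i - 1) \<cdot>\<^sub>m S_seq C \<mu> i + C (Suc i)"
  by (cases i) auto

lemma S_seq_carrier:
  assumes "1 \<le> i" "\<And>l. l \<in> {1..i} \<Longrightarrow> C l \<in> carrier_mat n n"
  shows "S_seq C \<mu> i \<in> carrier_mat n n"
  using assms
proof (induction i rule: dec_induct)
  case base
  then show ?case by simp
next
  case (step i)
  then show ?case by (simp add: S_seq_Suc)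
qed

lemma congr_S_seq_Suc:
  assumes "1 \<le> i" "\<And>l. l \<in> {1..Suc i} \<Longrightarrow> C l \<in> carrier_mat n n" "P \<in> carrier_mat n n"
  shows "congr P (S_seq C \<mu> (Suc i)) = \<mu> $ (i - 1) \<cdot>\<^sub>m congr P (S_seq C \<mu> i) + congr P (C (Suc i))"
  using assms S_seq_carrier[OF assms(1), of C n]
  by (simp add: S_seq_Suc congr_add[of _ n n] congr_smult[of _ n n])

text \<open>
Each \<open>S\<^sub>i\<close> is a combination of its predecessor and \<open>C\<^sub>i\<close> in which
\<open>C\<^sub>i\<close> has coefficient one, so either family lies in the span of the other.
\<close>
lemma diagonal_congr_S_seq_iff:
  assumes "1 \<le> k" "\<And>l. l \<in> {1..k} \<Longrightarrow> C l \<in> carrier_mat n n" and P: "P \<in> carrier_mat n n"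
  shows "(\<forall>i\<in>{1..k}. diagonal_mat (congr P (S_seq C \<mu> i))) \<longleftrightarrow>
    (\<forall>i\<in>{1..k}. diagonal_mat (congr P (C i)))"
  using assms(1,2)
proof (induction k rule: dec_induct)
  case base
  then show ?case by simp
next
  case (step k)
  have c: "congr P (S_seq C \<mu> k) \<in> carrier_mat n n" "congr P (C (Suc k)) \<in> carrier_mat n n"
    using step.hyps step.prems P S_seq_carrier[of k C n] by auto
  have "diagonal_mat (congr P (S_seq C \<mu> (Suc k))) \<longleftrightarrow> diagonal_mat (congr P (C (Suc k)))"
    if "diagonal_mat (congr P (S_seq C \<mu> k))"
    using that c congr_S_seq_Suc[OF step.hyps(1) step.prems P, where \<mu> = \<mu>]
    by (simp add: diagonal_mat_iff[of _ n])
  moreover have "{1..Suc k} = insert (Suc k) {1..k}" "k \<in> {1..k}" using step.hyps by auto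
  ultimately show ?case using step.IH step.prems by auto
qed

text \<open>
With constant weights \<open>t\<close> the recursion for a diagonal entry of \<open>S\<^sub>k\<close> is Horner's
scheme. The polynomial it evaluates has the entries of \<open>C\<^sub>1, \<dots>, C\<^sub>k\<close> as
coefficients, so it is the zero polynomial only if they all vanish; this is what makes a generic
\<open>t\<close> free of cancellation.
\<close>
lemma S_seq_diagonal_entry_poly:
  assumes "1 \<le> k" "\<And>l. l \<in> {1..k} \<Longrightarrow> C l \<in> carrier_mat n n" and P: "P \<in> carrier_mat n n" and j: "j < n"
  shows "\<exists>r. (r = 0 \<longleftrightarrow> (\<forall>l\<in>{1..k}. congr P (C l) $$ (j, j) = 0)) \<and>
    (\<forall>t \<mu>. (\<forall>i < k - 1. \<mu> $ i = t) \<longrightarrow> congr P (S_seq C \<mu> k) $$ (j, j) = poly r t)"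
  using assms(1,2)
proof (induction k rule: dec_induct)
  case base
  show ?case by (rule exI[of _ "[:congr P (C 1) $$ (j, j):]"]) simp
next
  case (step k)
  then obtain r where r: "r = 0 \<longleftrightarrow> (\<forall>l\<in>{1..k}. congr P (C l) $$ (j, j) = 0)"
    "\<And>t \<mu>. \<forall>i < k - 1. \<mu> $ i = t \<Longrightarrow> congr P (S_seq C \<mu> k) $$ (j, j) = poly r t"
    by auto
  let ?r = "pCons (congr P (C (Suc k)) $$ (j, j)) r"
  have "{1..Suc k} = insert (Suc k) {1..k}" by auto
  then have "?r = 0 \<longleftrightarrow> (\<forall>l\<in>{1..Suc k}. congr P (C l) $$ (j, j) = 0)"
    using r(1) by auto
  moreover have "congr P (S_seq C \<mu> (Suc k)) $$ (j, j) = poly ?r t"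
    if "\<forall>i < Suc k - 1. \<mu> $ i = t" for t \<mu>
  proof -
    have "congr P (S_seq C \<mu> k) \<in> carrier_mat n n" "congr P (C (Suc k)) \<in> carrier_mat n n"
      using step.hyps step.prems P S_seq_carrier[of k C n] by auto
    then show ?thesis
      using congr_S_seq_Suc[OF step.hyps(1) step.prems P, where \<mu> = \<mu>] r(2)[where \<mu> = \<mu> and t = t] that step.hyps j by simp
  qed
  ultimately show ?case by blast
qed

section \<open>Existence of the reduction\<close>

lemma mult_diagonal_index:
  fixes A L :: "real mat"
  assumes "A \<in> carrier_mat p q" "L \<in> carrier_mat q q" "diagonal_mat L" "i < p" "j < q"
  shows "(A * L) $$ (i, j) = A $$ (i, j) * L $$ (j, j)"
proof -
  have "col L j = L $$ (j, j) \<cdot>\<^sub>v unit_vec q j"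
    using assms by (intro eq_vecI) (auto simp: diagonal_mat_def)
  then show ?thesis using assms by (simp add: scalar_prod_right_unit[of _ q])
qed

lemma symmetric_corner:
  fixes A B E :: "real mat"
  assumes "A \<in> carrier_mat p p" "E \<in> carrier_mat q q"
    and "(four_block_mat A B C E)\<^sup>T = four_block_mat A B C E"
  shows "A\<^sup>T = A"
proof (rule eq_matI)
  fix i j assume "i < dim_row A" "j < dim_col A"
  then show "A\<^sup>T $$ (i, j) = A $$ (i, j)"
    using arg_cong[OF assms(3), of "\<lambda>M. M $$ (i, j)"] assms(1,2) by simp
qed (use assms in auto)

text \<open>
Block Gauss elimination, with the nonzero diagonal entries of \<open>congr V E\<close> as pivots. The
transformation has identity and zero as upper blocks, so by \<open>congr_lower_triangular_pad\<close> it
does not disturb matrices of the shape \<open>pad p q X\<close>.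
\<close>
lemma congr_to_form_b:
  fixes M :: "real mat"
  assumes "M \<in> carrier_mat (p + q) (p + q)" "M\<^sup>T = M"
  obtains X V A L K s where "X \<in> carrier_mat q p" "V \<in> carrier_mat q q" "invertible_mat V"
    "form_b (p + q) p s (congr (four_block_mat (1\<^sub>m p) (0\<^sub>m p q) X V) M) A K L"
proof -
  obtain A B E where b: "A \<in> carrier_mat p p" "B \<in> carrier_mat p q"
    "E \<in> carrier_mat q q" "E\<^sup>T = E" and M: "M = four_block_mat A B (B\<^sup>T) E"
    by (rule symmetric_split[OF assms])
  have "SDC q {E}"
    using symmetric_diagonalizable[OF b(3,4)] unfolding SDC_iff_congr by auto
  have carr: "N \<in> carrier_mat q q" if "N \<in> {E}" for N using that b(3) by simp
  from simultaneous_diagonalization_sorted[OF carr subset_refl \<open>SDC q {E}\<close>]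
  obtain V s where V: "V \<in> carrier_mat q q" "invertible_mat V" "\<And>N. N \<in> {E} \<Longrightarrow> diagonal_mat (congr V N)"
    and s: "s \<le> q" "\<And>j. j < q \<Longrightarrow> (\<exists>N\<in>{E}. congr V N $$ (j, j) \<noteq> 0) \<longleftrightarrow> j < s"
    by blast
  let ?L = "congr V E"
  have L_diag: "diagonal_mat ?L" using V(3) by simp
  have L: "?L \<in> carrier_mat q q" using V b by simp
  have zero: "?L $$ (j, j) = 0" if "s \<le> j" "j < q" for j using s(2)[of j] that by auto
  from diagonal_eq_pad[OF L L_diag s(1) zero]
  obtain Y where Y: "Y \<in> carrier_mat s s" "diagonal_mat Y" "?L = pad s (q - s) Y"
    and Y_inv: "(\<forall>j<s. ?L $$ (j, j) \<noteq> 0) \<longrightarrow> invertible_mat Y" by blast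
  have "invertible_mat Y" using Y_inv s by simp
  \<comment> \<open>The columns below \<open>s\<close> of \<open>B * V\<close> divided by their pivots: \<open>W * V = B * V - Z * ?L\<close> then loses exactly those columns.\<close>
  define Z where "Z = mat p q (\<lambda>(i, j). if j < s then (B * V) $$ (i, j) / ?L $$ (j, j) else 0)"
  define X where "X = - (V * Z\<^sup>T)"
  have Z: "Z \<in> carrier_mat p q" and X: "X \<in> carrier_mat q p" using V unfolding Z_def X_def by auto
  define W where "W = (1\<^sub>m p)\<^sup>T * B + X\<^sup>T * E"
  have W: "W \<in> carrier_mat p q" using X b unfolding W_def by auto
  have "X\<^sup>T = - (Z * V\<^sup>T)"
    unfolding X_def using V Z by (simp add: transpose_uminus transpose_mult[of _ q q _ p])
  then have WV: "W * V = B * V - Z * ?L"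
    unfolding W_def congr_def using V(1) Z b
    by (simp add: add_mult_distrib_mat[of _ p q] minus_add_uminus_mat[of _ p q] assoc_mult_mat[of _ p q _ q _ q])
  let ?K = "mat p (q - s) (\<lambda>(i, j). (B * V) $$ (i, s + j))"
  have "W * V = prepend_zero_cols p q s ?K"
  proof (rule eq_matI)
    fix i j assume "i < dim_row (prepend_zero_cols p q s ?K)" "j < dim_col (prepend_zero_cols p q s ?K)"
    then have ij: "i < p" "j < q" using s by (auto simp: prepend_zero_cols_def)
    have "(Z * ?L) $$ (i, j) = (if j < s then (B * V) $$ (i, j) else 0)"
      using mult_diagonal_index[OF Z L L_diag ij] ij s(2)[of j] zero[of j] by (auto simp: Z_def)
    then show "(W * V) $$ (i, j) = prepend_zero_cols p q s ?K $$ (i, j)"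
      unfolding WV using ij b V(1) Z carrier_matD[OF L] s(1)
      by (auto simp: prepend_zero_cols_def simp del: index_mult_mat(1))
  qed (use s W V in \<open>auto simp: prepend_zero_cols_def\<close>)
  let ?T = "four_block_mat (1\<^sub>m p) (0\<^sub>m p q) X V"
  let ?A = "((1\<^sub>m p)\<^sup>T * A + X\<^sup>T * B\<^sup>T) * 1\<^sub>m p + W * X"
  have A: "?A \<in> carrier_mat p p" using b X W by auto
  have T: "?T \<in> carrier_mat (p + q) (p + q)" using X V by auto
  have eq: "congr ?T M = four_block_mat ?A (W * V) ((W * V)\<^sup>T) ?L"
    unfolding M W_def by (rule congr_lower_triangular[OF one_carrier_mat X V(1) b])
  have "(congr ?T M)\<^sup>T = congr ?T M" using transpose_congr[OF T assms(1)] assms(2) by simp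
  then have "?A\<^sup>T = ?A" unfolding eq using symmetric_corner[OF A L] by blast
  have "form_b (p + q) p s (congr ?T M) ?A ?K Y"
    unfolding form_b_def eq \<open>W * V = prepend_zero_cols p q s ?K\<close> Y(3)
    using form_b_eq_four_block[OF s(1) A _ Y(1), of ?K] s(1) A \<open>?A\<^sup>T = ?A\<close> Y \<open>invertible_mat Y\<close> by auto
  with X V(1,2) that show thesis by blast
qed

lemma exists_positive_nonroot:
  fixes r :: "nat \<Rightarrow> real poly"
  obtains t where "t > 0" "\<And>j. j < n \<Longrightarrow> r j \<noteq> 0 \<Longrightarrow> poly (r j) t \<noteq> 0"
proof -
  have "finite (\<Union>j\<in>{j. j < n \<and> r j \<noteq> 0}. {t. poly (r j) t = 0})"
    by (auto intro: poly_roots_finite)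
  moreover have "infinite {0 :: real <..}" by (rule infinite_Ioi)
  ultimately have "infinite ({0 <..} - (\<Union>j\<in>{j. j < n \<and> r j \<noteq> 0}. {t. poly (r j) t = 0}))"
    by (rule Diff_infinite_finite)
  from infinite_imp_nonempty[OF this] that show thesis by auto
qed

text \<open>
The transformation is \<open>Q = P * T\<close>, where \<open>P\<close> diagonalizes
\<open>C\<^sub>1, \<dots>, C\<^sub>m\<^sub>-\<^sub>1\<close> with their joint support in front, and \<open>T\<close>
brings the last matrix to form (b).
\<close>
lemma exists_reduction:
  assumes m: "m \<ge> 3"
    and C: "\<And>i. i \<in> {1..m} \<Longrightarrow> C i \<in> carrier_mat n n"
    and sym: "(C m)\<^sup>T = C m"
    and sdc: "SDC n (C ` {1..m - 1})"
  obtains p Q \<mu> D s K L where "reduction n m C p Q \<mu> D" "form_b n p s (Cbar m C Q \<mu> m) (D m) K L"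
proof -
  have C': "X \<in> carrier_mat n n" if "X \<in> C ` {1..m - 1}" for X using that C m by auto
  have Ci: "C l \<in> carrier_mat n n" if "l \<in> {1..i}" "i \<le> m - 1" for l i using that C m by auto
  obtain P p where P: "P \<in> carrier_mat n n" "invertible_mat P"
    and diag: "\<And>X. X \<in> C ` {1..m - 1} \<Longrightarrow> diagonal_mat (congr P X)"
    and p: "p \<le> n" "\<And>j. j < n \<Longrightarrow> (\<exists>X\<in>C ` {1..m - 1}. congr P X $$ (j, j) \<noteq> 0) \<longleftrightarrow> j < p"
    using simultaneous_diagonalization_sorted[OF C' subset_refl sdc] by blast
  obtain q where q: "n = p + q" using p(1) le_Suc_ex by blast
  have ex: "\<exists>r. (r = 0 \<longleftrightarrow> (\<forall>l\<in>{1..i}. congr P (C l) $$ (j, j) = 0)) \<and>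
    (\<forall>t \<mu>. (\<forall>k < i - 1. \<mu> $ k = t) \<longrightarrow> congr P (S_seq C \<mu> i) $$ (j, j) = poly r t)"
    if "1 \<le> i" "i \<le> m - 1" "j < n" for i j
    by (rule S_seq_diagonal_entry_poly[OF that(1) _ P(1) that(3)]) (use Ci that in auto)
  have "\<forall>j. \<exists>r. j < n \<longrightarrow> (r = 0 \<longleftrightarrow> (\<forall>l\<in>{1..m - 1}. congr P (C l) $$ (j, j) = 0)) \<and>
    (\<forall>t \<mu>. (\<forall>k < m - 1 - 1. \<mu> $ k = t) \<longrightarrow> congr P (S_seq C \<mu> (m - 1)) $$ (j, j) = poly r t)"
    using ex[of "m - 1"] m by auto
  from choice[OF this] obtain r where r': "\<forall>j<n. (r j = 0 \<longleftrightarrow> (\<forall>l\<in>{1..m - 1}. congr P (C l) $$ (j, j) = 0)) \<and>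
    (\<forall>t \<mu>. (\<forall>k < m - 1 - 1. \<mu> $ k = t) \<longrightarrow> congr P (S_seq C \<mu> (m - 1)) $$ (j, j) = poly (r j) t)"
    by blast
  have r: "r j = 0 \<longleftrightarrow> (\<forall>l\<in>{1..m - 1}. congr P (C l) $$ (j, j) = 0)" if "j < n" for j
    using r' that by blast
  have rS: "congr P (S_seq C \<mu> (m - 1)) $$ (j, j) = poly (r j) t"
    if "j < n" "\<forall>k < m - 1 - 1. \<mu> $ k = t" for j t \<mu>
    using r' that by blast
  obtain t where t: "t > 0" "\<And>j. j < n \<Longrightarrow> r j \<noteq> 0 \<Longrightarrow> poly (r j) t \<noteq> 0"
    using exists_positive_nonroot[of n r] by blast
  \<comment> \<open>The weights that enter \<open>S\<^sub>m\<^sub>-\<^sub>1\<close> have the indices below \<open>m - 2\<close>; the entry at \<open>m - 2\<close> is the normalizing 1.\<close>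
  define \<mu> where "\<mu> = vec (m - 1) (\<lambda>k. if k = m - 2 then 1 else t)"
  let ?S = "S_seq C \<mu>"
  have \<mu>: "\<forall>k < i - 1. \<mu> $ k = t" if "i \<le> m - 1" for i using that by (auto simp: \<mu>_def)
  have S: "?S i \<in> carrier_mat n n" if "i \<in> {1..m - 1}" for i
    using S_seq_carrier[of i C n] Ci that by auto
  have S_diag: "diagonal_mat (congr P (?S i))" if "i \<in> {1..m - 1}" for i
  proof -
    have "(\<forall>i\<in>{1..m - 1}. diagonal_mat (congr P (?S i))) \<longleftrightarrow> (\<forall>i\<in>{1..m - 1}. diagonal_mat (congr P (C i)))"
      by (rule diagonal_congr_S_seq_iff) (use m Ci P in auto)
    with diag that show ?thesis by blast
  qed
  have S_zero: "congr P (?S i) $$ (j, j) = 0" if i: "i \<in> {1..m - 1}" and j: "p \<le> j" "j < n" for i j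
  proof -
    have "congr P (C l) $$ (j, j) = 0" if "l \<in> {1..i}" for l
      using p(2)[of j] i j that by force
    with ex[of i j] \<mu>[of i] i j show ?thesis by auto
  qed
  have S_nz: "congr P (?S (m - 1)) $$ (j, j) \<noteq> 0" if "j < p" for j
  proof -
    have "j < n" using that p(1) by simp
    with r p(2) that have "r j \<noteq> 0" by blast
    with t(2) rS[OF \<open>j < n\<close> \<mu>] \<open>j < n\<close> show ?thesis by simp
  qed
  have "\<exists>Y. Y \<in> carrier_mat p p \<and> diagonal_mat Y \<and> congr P (?S i) = pad p q Y \<and> (i = m - 1 \<longrightarrow> invertible_mat Y)"
    if i: "i \<in> {1..m - 1}" for i
  proof -
    from diagonal_eq_pad[OF congr_carrier[OF P(1) S[OF i]] S_diag[OF i] p(1) S_zero[OF i]]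
    obtain Y where "Y \<in> carrier_mat p p" "diagonal_mat Y" "congr P (?S i) = pad p (n - p) Y"
      "(\<forall>j<p. congr P (?S i) $$ (j, j) \<noteq> 0) \<longrightarrow> invertible_mat Y" by blast
    then show ?thesis using S_nz q by auto
  qed
  then have "\<forall>i. \<exists>Y. i \<in> {1..m - 1} \<longrightarrow> Y \<in> carrier_mat p p \<and> diagonal_mat Y \<and>
      congr P (?S i) = pad p q Y \<and> (i = m - 1 \<longrightarrow> invertible_mat Y)"
    by blast
  from choice[OF this] obtain Y where Y: "\<And>i. i \<in> {1..m - 1} \<Longrightarrow> Y i \<in> carrier_mat p p \<and> diagonal_mat (Y i) \<and>
      congr P (?S i) = pad p q (Y i) \<and> (i = m - 1 \<longrightarrow> invertible_mat (Y i))"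
    by blast
  have Cm: "C m \<in> carrier_mat n n" using C m by auto
  have "congr P (C m) \<in> carrier_mat (p + q) (p + q)" "(congr P (C m))\<^sup>T = congr P (C m)"
    using congr_carrier[OF P(1) Cm] transpose_congr[OF P(1) Cm] sym q by auto
  then obtain X V A L K s where X: "X \<in> carrier_mat q p" and V: "V \<in> carrier_mat q q" "invertible_mat V"
    and fb': "form_b (p + q) p s (congr (four_block_mat (1\<^sub>m p) (0\<^sub>m p q) X V) (congr P (C m))) A K L"
    by (rule congr_to_form_b)
  let ?T = "four_block_mat (1\<^sub>m p) (0\<^sub>m p q) X V"
  note b = one_carrier_mat[of p] X V(1)
  have T: "?T \<in> carrier_mat n n" "invertible_mat ?T"
    using b V invertible_lower_triangular_iff[OF b] invertible_mat_iff_det[of "1\<^sub>m p :: real mat" p] q by auto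
  define Q where "Q = P * ?T"
  have Q: "Q \<in> carrier_mat n n" "invertible_mat Q"
    using P T invertible_mat_mult unfolding Q_def by auto
  define D where "D i = (if i = m then A else Y i)" for i
  have D: "D i \<in> carrier_mat p p \<and> diagonal_mat (D i) \<and>
      Cbar m C Q \<mu> i = diag_block_mat [D i, 0\<^sub>m (n - p) (n - p)]" if "i \<in> {1..m - 1}" for i
  proof -
    have "i < m" using that m by auto
    have y: "Y i \<in> carrier_mat p p" using Y[OF that] by simp
    have "Cbar m C Q \<mu> i = congr Q (?S i)" using \<open>i < m\<close> by (simp add: Cbar_def congr_def)
    also have "\<dots> = congr ?T (pad p q (Y i))"
      unfolding Q_def using congr_mult[OF P(1) T(1) S[OF that]] Y[OF that] by simp
    also have "\<dots> = pad p q (Y i)"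
      using congr_lower_triangular_pad[OF b y] congr_one[OF y] by simp
    finally show ?thesis using Y[OF that] \<open>i < m\<close> q by (auto simp: D_def Let_def)
  qed
  have "reduction n m C p Q \<mu> D"
    unfolding reduction_def using p(1) Q t(1) D Y[of "m - 1"] m by (auto simp: \<mu>_def D_def)
  moreover have "Cbar m C Q \<mu> m = congr Q (C m)" by (simp add: Cbar_def congr_def)
  then have "form_b n p s (Cbar m C Q \<mu> m) (D m) K L"
    using fb'[folded q] congr_mult[OF P(1) T(1) Cm] by (simp add: Q_def D_def)
  ultimately show thesis by (rule that)
qed

section \<open>Consequences of a reduction\<close>

lemma SDC_congr_image_iff:
  assumes Q: "Q \<in> carrier_mat n n" "invertible_mat Q"
    and M: "\<And>X. X \<in> \<M> \<Longrightarrow> X \<in> carrier_mat n n"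
  shows "SDC n (congr Q ` \<M>) \<longleftrightarrow> SDC n \<M>"
proof
  assume "SDC n (congr Q ` \<M>)"
  then obtain P where P: "P \<in> carrier_mat n n" "invertible_mat P"
    "\<And>X. X \<in> \<M> \<Longrightarrow> diagonal_mat (congr P (congr Q X))"
    unfolding SDC_iff_congr by auto
  then have "\<forall>X\<in>\<M>. diagonal_mat (congr (Q * P) X)"
    using congr_mult[OF Q(1) P(1) M] by simp
  moreover have "Q * P \<in> carrier_mat n n" "invertible_mat (Q * P)"
    using P Q invertible_mat_mult by auto
  ultimately show "SDC n \<M>" unfolding SDC_iff_congr by blast
next
  assume "SDC n \<M>"
  then obtain P where P: "P \<in> carrier_mat n n" "invertible_mat P"
    "\<And>X. X \<in> \<M> \<Longrightarrow> diagonal_mat (congr P X)"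
    unfolding SDC_iff_congr by auto
  obtain R where R: "R \<in> carrier_mat n n" "Q * R = 1\<^sub>m n" "invertible_mat R"
    using invertible_mat_inverse[OF Q] by metis
  have RP: "R * P \<in> carrier_mat n n" "invertible_mat (R * P)"
    using P R invertible_mat_mult by auto
  have "Q * (R * P) = P"
    using Q R P by (simp add: assoc_mult_mat[of Q n n R n P n, symmetric] del: assoc_mult_mat)
  then have "diagonal_mat (congr (R * P) (congr Q X))" if "X \<in> \<M>" for X
    using congr_mult[OF Q(1) RP(1) M[OF that]] P(3)[OF that] by simp
  with RP show "SDC n (congr Q ` \<M>)" unfolding SDC_iff_congr by blast
qed

lemma reduction_blocks:
  assumes red: "reduction n m C p Q \<mu> D" and i: "i \<in> {1..m - 1}"
  shows "D i \<in> carrier_mat p p"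
    and "Cbar m C Q \<mu> i = congr Q (S_seq C \<mu> i)"
    and "Cbar m C Q \<mu> i = pad p (n - p) (D i)"
proof -
  from red i show D: "D i \<in> carrier_mat p p" unfolding reduction_def by blast
  show "Cbar m C Q \<mu> i = congr Q (S_seq C \<mu> i)"
    using i by (auto simp: Cbar_def congr_def)
  have "Cbar m C Q \<mu> i = diag_block_mat [D i, 0\<^sub>m (n - p) (n - p)]"
    using red i unfolding reduction_def by blast
  then show "Cbar m C Q \<mu> i = pad p (n - p) (D i)" using D by (simp add: Let_def)
qed

text \<open>
The combination that expresses each \<open>S\<^sub>i\<close> by its predecessor and \<open>C\<^sub>i\<close> also
preserves the common kernel.
\<close>
lemma common_kernel_S_seq_iff:
  assumes "1 \<le> k" "\<And>l. l \<in> {1..k} \<Longrightarrow> C l \<in> carrier_mat n n" and v: "v \<in> carrier_vec n"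
  shows "(\<forall>i\<in>{1..k}. S_seq C \<mu> i *\<^sub>v v = 0\<^sub>v n) \<longleftrightarrow> (\<forall>i\<in>{1..k}. C i *\<^sub>v v = 0\<^sub>v n)"
  using assms(1,2)
proof (induction k rule: dec_induct)
  case base
  then show ?case by simp
next
  case (step k)
  have S: "S_seq C \<mu> k \<in> carrier_mat n n" "C (Suc k) \<in> carrier_mat n n"
    using step.hyps step.prems S_seq_carrier[of k C n] by auto
  have smult: "(a \<cdot>\<^sub>m S_seq C \<mu> k) *\<^sub>v v = a \<cdot>\<^sub>v (S_seq C \<mu> k *\<^sub>v v)" for a
    using S v by (intro eq_vecI) auto
  have zero: "a \<cdot>\<^sub>v 0\<^sub>v n = 0\<^sub>v n" for a :: real by (intro eq_vecI) auto
  have "S_seq C \<mu> (Suc k) *\<^sub>v v = \<mu> $ (k - 1) \<cdot>\<^sub>v (S_seq C \<mu> k *\<^sub>v v) + C (Suc k) *\<^sub>v v"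
    using S v step.hyps(1) by (simp add: S_seq_Suc add_mult_distrib_mat_vec[of _ n n] smult)
  then have "S_seq C \<mu> (Suc k) *\<^sub>v v = 0\<^sub>v n \<longleftrightarrow> C (Suc k) *\<^sub>v v = 0\<^sub>v n"
    if "S_seq C \<mu> k *\<^sub>v v = 0\<^sub>v n"
    using that S v by (simp add: zero)
  moreover have "{1..Suc k} = insert (Suc k) {1..k}" "k \<in> {1..k}" using step.hyps by auto
  ultimately show ?case using step.IH step.prems by auto
qed

text \<open>
The common kernel of \<open>C\<^sub>1, \<dots>, C\<^sub>m\<^sub>-\<^sub>1\<close> is that of the \<open>S\<^sub>i\<close>. If
\<open>p < n\<close> it contains column \<open>p\<close> of \<open>Q\<close>, and if \<open>p = n\<close> then
\<open>S\<^sub>m\<^sub>-\<^sub>1\<close> is nonsingular.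
\<close>
lemma reduction_common_kernel_iff:
  assumes red: "reduction n m C p Q \<mu> D" and m: "m \<ge> 2"
    and C: "\<And>i. i \<in> {1..m} \<Longrightarrow> C i \<in> carrier_mat n n"
  shows "p < n \<longleftrightarrow> (\<exists>v \<in> carrier_vec n. v \<noteq> 0\<^sub>v n \<and> (\<forall>i \<in> {1..m - 1}. C i *\<^sub>v v = 0\<^sub>v n))"
proof -
  let ?S = "S_seq C \<mu>"
  have Q: "Q \<in> carrier_mat n n" "invertible_mat Q" and p: "p \<le> n"
    and D_inv: "invertible_mat (D (m - 1))"
    using red by (auto simp: reduction_def)
  note D = reduction_blocks(1)[OF red]
  have eq: "congr Q (?S i) = pad p (n - p) (D i)" if "i \<in> {1..m - 1}" for i
    using reduction_blocks(2,3)[OF red that] by simp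
  have S: "?S i \<in> carrier_mat n n" if "i \<in> {1..m - 1}" for i
    by (rule S_seq_carrier) (use C that in auto)
  have ker: "(\<forall>i\<in>{1..m - 1}. ?S i *\<^sub>v v = 0\<^sub>v n) \<longleftrightarrow> (\<forall>i\<in>{1..m - 1}. C i *\<^sub>v v = 0\<^sub>v n)"
    if "v \<in> carrier_vec n" for v
    by (rule common_kernel_S_seq_iff) (use m C that in auto)
  obtain R where R: "R \<in> carrier_mat n n" "Q * R = 1\<^sub>m n" "R * Q = 1\<^sub>m n"
    using invertible_mat_inverse[OF Q] by metis
  have RQ: "R\<^sup>T * Q\<^sup>T = 1\<^sub>m n" using R Q by (metis transpose_mult transpose_one)
  have mult_zero: "M *\<^sub>v 0\<^sub>v n = 0\<^sub>v n" if "M \<in> carrier_mat n n" for M :: "real mat"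
    using that by (intro eq_vecI) auto
  show ?thesis
  proof
    assume pn: "p < n"
    let ?v = "col Q p"
    have v: "?v \<in> carrier_vec n" using Q by auto
    have "R *\<^sub>v ?v = col (R * Q) p" using R(1) Q(1) pn by (intro eq_vecI) auto
    then have Re: "R *\<^sub>v ?v = unit_vec n p" unfolding R(3) using pn by simp
    have "?v \<noteq> 0\<^sub>v n"
    proof
      assume "?v = 0\<^sub>v n"
      with Re mult_zero[OF R(1)] have "unit_vec n p = (0\<^sub>v n :: real vec)" by simp
      moreover have "unit_vec n p \<noteq> (0\<^sub>v n :: real vec)" by (rule unit_vec_nonzero[OF pn])
      ultimately show False by simp
    qed
    moreover have "?S i *\<^sub>v ?v = 0\<^sub>v n" if i: "i \<in> {1..m - 1}" for i
    proof -
      have SQ: "?S i * Q \<in> carrier_mat n n" using Q S[OF i] by simp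
      have "col (congr Q (?S i)) p = col (Q\<^sup>T * (?S i * Q)) p" using Q S[OF i] by (simp add: congr_def)
      also have "\<dots> = Q\<^sup>T *\<^sub>v col (?S i * Q) p"
        by (rule col_mult2[OF _ SQ pn]) (use Q in simp)
      also have "col (?S i * Q) p = ?S i *\<^sub>v ?v" by (rule col_mult2[OF S[OF i] Q(1) pn])
      finally have "Q\<^sup>T *\<^sub>v (?S i *\<^sub>v ?v) = col (congr Q (?S i)) p" ..
      also have "\<dots> = 0\<^sub>v n"
        unfolding eq[OF i] using D[OF i] pn p by (intro eq_vecI) auto
      finally have "R\<^sup>T *\<^sub>v (Q\<^sup>T *\<^sub>v (?S i *\<^sub>v ?v)) = 0\<^sub>v n" using mult_zero[of "R\<^sup>T"] R(1) by simp
      moreover have "?S i *\<^sub>v ?v \<in> carrier_vec n" using S[OF i] v by simp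
      then have "R\<^sup>T *\<^sub>v (Q\<^sup>T *\<^sub>v (?S i *\<^sub>v ?v)) = ?S i *\<^sub>v ?v"
        using RQ R(1) Q(1) by (simp add: assoc_mult_mat_vec[of "R\<^sup>T" n n "Q\<^sup>T" n, symmetric] del: assoc_mult_mat_vec)
      ultimately show ?thesis by simp
    qed
    ultimately show "\<exists>v \<in> carrier_vec n. v \<noteq> 0\<^sub>v n \<and> (\<forall>i \<in> {1..m - 1}. C i *\<^sub>v v = 0\<^sub>v n)"
      using ker v by blast
  next
    assume "\<exists>v \<in> carrier_vec n. v \<noteq> 0\<^sub>v n \<and> (\<forall>i \<in> {1..m - 1}. C i *\<^sub>v v = 0\<^sub>v n)"
    then obtain v where v: "v \<in> carrier_vec n" "v \<noteq> 0\<^sub>v n" "\<forall>i \<in> {1..m - 1}. ?S i *\<^sub>v v = 0\<^sub>v n"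
      using ker by blast
    have l: "m - 1 \<in> {1..m - 1}" using m by auto
    have "det (?S (m - 1)) = 0"
      using det_0_iff_vec_prod_zero[OF S[OF l]] v l by blast
    then have "det (congr Q (?S (m - 1))) = 0"
      using Q S[OF l] by (simp add: congr_def det_mult[of _ n])
    show "p < n"
    proof (rule ccontr)
      assume "\<not> p < n"
      then have "p = n" using p by simp
      then have "congr Q (?S (m - 1)) = D (m - 1)"
        unfolding eq[OF l] using D[OF l] by (intro eq_matI) auto
      with D[OF l] D_inv \<open>det (congr Q (?S (m - 1))) = 0\<close> show False
        by (simp add: invertible_mat_iff_det)
    qed
  qed
qed

text \<open>
The equivalence of (i) and (ii): replacing \<open>C\<^sub>i\<close> by \<open>S\<^sub>i\<close> does not change which
matrices diagonalize the family, and the congruence by \<open>Q\<close> only changes them by the factor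
\<open>Q\<close>.
\<close>
lemma SDC_Cbar_iff:
  assumes red: "reduction n m C p Q \<mu> D" and m: "m \<ge> 2"
    and C: "\<And>i. i \<in> {1..m} \<Longrightarrow> C i \<in> carrier_mat n n"
  shows "SDC n (C ` {1..m}) \<longleftrightarrow> SDC n (Cbar m C Q \<mu> ` {1..m})"
proof -
  let ?S = "S_seq C \<mu>"
  have Q: "Q \<in> carrier_mat n n" "invertible_mat Q" using red by (auto simp: reduction_def)
  have split: "{1..m} = insert m {1..m - 1}" using m by auto
  have S: "X \<in> carrier_mat n n" if "X \<in> insert (C m) (?S ` {1..m - 1})" for X
  proof -
    have "?S i \<in> carrier_mat n n" if "i \<in> {1..m - 1}" for i
      by (rule S_seq_carrier) (use C that in auto)
    with that C m show ?thesis by auto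
  qed
  have "Cbar m C Q \<mu> m = congr Q (C m)" by (simp add: Cbar_def congr_def)
  moreover have "Cbar m C Q \<mu> ` {1..m - 1} = congr Q ` ?S ` {1..m - 1}"
    unfolding image_image by (rule image_cong) (rule refl, rule reduction_blocks(2)[OF red])
  ultimately have image: "Cbar m C Q \<mu> ` {1..m} = congr Q ` insert (C m) (?S ` {1..m - 1})"
    unfolding split by simp
  have "SDC n (Cbar m C Q \<mu> ` {1..m}) \<longleftrightarrow> SDC n (insert (C m) (?S ` {1..m - 1}))"
    unfolding image by (rule SDC_congr_image_iff[OF Q S])
  also have "\<dots> \<longleftrightarrow> SDC n (C ` {1..m})"
  proof -
    have "(\<forall>i\<in>{1..m - 1}. diagonal_mat (congr P (?S i))) \<longleftrightarrow> (\<forall>i\<in>{1..m - 1}. diagonal_mat (congr P (C i)))"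
      if "P \<in> carrier_mat n n" for P
      by (rule diagonal_congr_S_seq_iff) (use m C that in auto)
    then show ?thesis unfolding SDC_iff_congr split by (auto simp: ball_simps)
  qed
  finally show ?thesis ..
qed

lemma SDC_Cbar_block_iff:
  assumes red: "reduction n m C p Q \<mu> D" and m: "m \<ge> 2"
    and c: "D m \<in> carrier_mat p p" "B \<in> carrier_mat p (n - p)" "E \<in> carrier_mat (n - p) (n - p)"
    and E: "diagonal_mat E"
    and cols: "\<And>j. j < n - p \<Longrightarrow> col B j = 0\<^sub>v p \<or> col E j = 0\<^sub>v (n - p)"
    and eq: "Cbar m C Q \<mu> m = four_block_mat (D m) B (B\<^sup>T) E"
  shows "SDC n (Cbar m C Q \<mu> ` {1..m}) \<longleftrightarrow> SDC p (D ` {1..m}) \<and> B = 0\<^sub>m p (n - p)"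
proof -
  have D_inv: "invertible_mat (D (m - 1))" and p: "p \<le> n"
    using red by (auto simp: reduction_def)
  have split: "{1..m} = insert m {1..m - 1}" using m by auto
  have "Cbar m C Q \<mu> ` {1..m - 1} = pad p (n - p) ` D ` {1..m - 1}"
    unfolding image_image by (rule image_cong) (rule refl, rule reduction_blocks(3)[OF red])
  then have "Cbar m C Q \<mu> ` {1..m} = insert (four_block_mat (D m) B (B\<^sup>T) E) (pad p (n - p) ` (D ` {1..m - 1}))"
    unfolding split by (simp add: eq)
  moreover have "D ` {1..m} = insert (D m) (D ` {1..m - 1})" unfolding split by simp
  moreover have mem: "D (m - 1) \<in> D ` {1..m - 1}" using m by auto
  have carr: "X \<in> carrier_mat p p" if "X \<in> D ` {1..m - 1}" for X
    using that reduction_blocks(1)[OF red] by blast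
  have "p + (n - p) = n" using p by simp
  ultimately show ?thesis
    using SDC_block_iff[OF carr mem D_inv c E cols] by simp
qed

section \<open>Reduction and equivalence\<close>

theorem theorem3:
  fixes n m :: nat and C :: "nat \<Rightarrow> real mat"
  assumes "m \<ge> 3"
    and "\<And>i. i \<in> {1..m} \<Longrightarrow> C i \<in> carrier_mat n n"
    and "\<And>i. i \<in> {1..m} \<Longrightarrow> transpose_mat (C i) = C i"
    and "\<And>i. i \<in> {1..m} \<Longrightarrow> C i \<noteq> 0\<^sub>m n n"
    and "\<And>i. i \<in> {1..m} \<Longrightarrow> \<not> invertible_mat (C i)"
    and "SDC n (C ` {1..m - 1})"
  shows "(\<exists>p Q \<mu> D. reduction n m C p Q \<mu> D \<and>
            (p < n \<longleftrightarrow>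
               (\<exists>v \<in> carrier_vec n. v \<noteq> 0\<^sub>v n \<and> (\<forall>i \<in> {1..m - 1}. C i *\<^sub>v v = 0\<^sub>v n))) \<and>
            ((\<exists>Cm2. form_a n p (Cbar m C Q \<mu> m) (D m) Cm2) \<or>
             (\<exists>s Cm5 Cm6. form_b n p s (Cbar m C Q \<mu> m) (D m) Cm5 Cm6)))
       \<and> (\<forall>p Q \<mu> D. reduction n m C p Q \<mu> D \<longrightarrow>
            (\<forall>Cm2. form_a n p (Cbar m C Q \<mu> m) (D m) Cm2 \<longrightarrow>
               (SDC n (C ` {1..m}) \<longleftrightarrow> SDC n (Cbar m C Q \<mu> ` {1..m})) \<and>
               (SDC n (Cbar m C Q \<mu> ` {1..m}) \<longleftrightarrow>
                  SDC p (D ` {1..m}) \<and> Cm2 = 0\<^sub>m p (n - p))) \<and>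
            (\<forall>s Cm5 Cm6. form_b n p s (Cbar m C Q \<mu> m) (D m) Cm5 Cm6 \<longrightarrow>
               (SDC n (C ` {1..m}) \<longleftrightarrow> SDC n (Cbar m C Q \<mu> ` {1..m})) \<and>
               (SDC n (Cbar m C Q \<mu> ` {1..m}) \<longleftrightarrow>
                  SDC p (D ` {1..m}) \<and> (Cm5 = 0\<^sub>m p (n - p - s) \<or> s = n - p))))"
    (is "?existence \<and> ?equivalence")
proof
  have m: "m \<ge> 2" using assms(1) by simp
  have sym: "(C m)\<^sup>T = C m" using assms(1,3) by simp
  obtain p Q \<mu> D s K L where "reduction n m C p Q \<mu> D" "form_b n p s (Cbar m C Q \<mu> m) (D m) K L"
    by (rule exists_reduction[OF assms(1,2) sym assms(6)])
  moreover from reduction_common_kernel_iff[OF this(1) m assms(2)]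
  have "p < n \<longleftrightarrow> (\<exists>v \<in> carrier_vec n. v \<noteq> 0\<^sub>v n \<and> (\<forall>i \<in> {1..m - 1}. C i *\<^sub>v v = 0\<^sub>v n))" .
  ultimately show ?existence by blast
  show ?equivalence
  proof (intro allI impI conjI)
    fix p Q \<mu> D Cm2
    assume red: "reduction n m C p Q \<mu> D" and a: "form_a n p (Cbar m C Q \<mu> m) (D m) Cm2"
    show "SDC n (C ` {1..m}) \<longleftrightarrow> SDC n (Cbar m C Q \<mu> ` {1..m})"
      by (rule SDC_Cbar_iff[OF red m assms(2)])
    show "SDC n (Cbar m C Q \<mu> ` {1..m}) \<longleftrightarrow> SDC p (D ` {1..m}) \<and> Cm2 = 0\<^sub>m p (n - p)"
      by (rule SDC_Cbar_block_iff[OF red m, where E = "0\<^sub>m (n - p) (n - p)"])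
        (use a in \<open>auto simp: form_a_def diagonal_mat_def\<close>)
  next
    fix p Q \<mu> D s Cm5 Cm6
    assume red: "reduction n m C p Q \<mu> D" and b: "form_b n p s (Cbar m C Q \<mu> m) (D m) Cm5 Cm6"
    show "SDC n (C ` {1..m}) \<longleftrightarrow> SDC n (Cbar m C Q \<mu> ` {1..m})"
      by (rule SDC_Cbar_iff[OF red m assms(2)])
    from b have s: "s \<le> n - p" and K: "Cm5 \<in> carrier_mat p (n - p - s)" and A: "D m \<in> carrier_mat p p"
      and L: "Cm6 \<in> carrier_mat s s" "diagonal_mat Cm6"
      and eq: "Cbar m C Q \<mu> m = four_block_mat (D m) (prepend_zero_cols p (n - p) s Cm5)
        ((prepend_zero_cols p (n - p) s Cm5)\<^sup>T) (pad s (n - p - s) Cm6)"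
      using form_b_eq_four_block[of s "n - p" "D m" p Cm5 Cm6] unfolding form_b_def by auto
    have "SDC n (Cbar m C Q \<mu> ` {1..m}) \<longleftrightarrow> SDC p (D ` {1..m}) \<and> prepend_zero_cols p (n - p) s Cm5 = 0\<^sub>m p (n - p)"
    proof (rule SDC_Cbar_block_iff[OF red m A _ _ _ _ eq])
      show "prepend_zero_cols p (n - p) s Cm5 \<in> carrier_mat p (n - p)" using s K by (auto simp: prepend_zero_cols_def)
      show "pad s (n - p - s) Cm6 \<in> carrier_mat (n - p) (n - p)" using s L by auto
      show "diagonal_mat (pad s (n - p - s) Cm6)" using L by (auto simp: diagonal_mat_def)
      fix j assume "j < n - p"
      show "col (prepend_zero_cols p (n - p) s Cm5) j = 0\<^sub>v p \<or> col (pad s (n - p - s) Cm6) j = 0\<^sub>v (n - p)"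
      proof (cases "j < s")
        case True
        then have "col (prepend_zero_cols p (n - p) s Cm5) j = 0\<^sub>v p"
          using s K by (intro eq_vecI) (auto simp: prepend_zero_cols_def)
        then show ?thesis ..
      next
        case False
        then have "col (pad s (n - p - s) Cm6) j = 0\<^sub>v (n - p)"
          using s L \<open>j < n - p\<close> by (intro eq_vecI) auto
        then show ?thesis ..
      qed
    qed
    then show "SDC n (Cbar m C Q \<mu> ` {1..m}) \<longleftrightarrow>
        SDC p (D ` {1..m}) \<and> (Cm5 = 0\<^sub>m p (n - p - s) \<or> s = n - p)"
      using prepend_zero_cols_eq_0_iff[OF s K] K by auto
  qed
qed

end
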